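(* Let $\mathcal B$ be the bialgebra of operadic trees and let $G=\sum_T \delta_T/|\operatorname{Aut}(T)|$ be its Green function, the sum being over all isomorphism classes of operadic trees. Write $G=\sum_{n\in\mathbb N}g_n$, where $g_n$ is the summand in the Green function corresponding to trees with $n$ leaves. Then $$\Delta(G)=\sum_{n\in\mathbb N}G^n\otimes g_n .$$
   Context: An operadic tree is a diagram of finite sets $A\xleftarrow{s}M\xrightarrow{p}N\xrightarrow{t}A$ such that $t$ is injective; $s$ is injective with singleton complement $\{1\}$ (the root); and, with $\sigma:A\to A$ given by $\sigma(1)=1$ and $\sigma(s(e))=t(p(e))$, for every $x\in A$ there is $k\in\mathbb N$ with $\sigma^k(x)=1$. Elements of $A$ are edges, elements of $N$ are nodes, $t(n)$ is the output edge of the node $n$, $p^{-1}(n)$ its set of input edges, and the leaves are the elements of $A\setminus t(N)$. (So nodes with no inputs are allowed and are not leaves; the trivial tree has one edge, which is both root and leaf, and no nodes.) A tree embedding is a triple of (necessarily injective) maps $A'\to A$, $M'\to M$, $N'\to N$ commuting with the structure maps and such that the square over $p$ is a pullback (so arities are preserved: a node in a subtree comes with all its incident edges). Isomorphisms of trees are the invertible embeddings. A cut of a tree $T$ is a subtree $c:S\subset T$ containing the root edge (the root edge alone and $T$ itself are both allowed). Each leaf $\ell$ of $S$ determines an ideal subtree of $T$, with root $\ell$, consisting of all edges $x$ of $T$ with $\sigma^k(x)=\ell$ for some $k\ge0$ and all nodes whose output edge is such an edge (it is the trivial tree if $\ell$ is a leaf of $T$). $P_c$ is the forest of all these ideal subtrees,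 one for each leaf of $S$. $\mathcal B$ is the polynomial algebra on the set of isomorphism classes of operadic trees; the generator of a tree $T$ is written $\delta_T$ (or $T$), and a forest is identified with the monomial given by the product of its trees. The comultiplication is the algebra map given on generators by $\Delta(T)=\sum_{c:S\subset T}P_c\otimes S$, the sum being over all cuts, and it is extended to the completion of $\mathcal B$ (the power series ring on the same generators), with values in the correspondingly completed tensor product. $G$ and $g_n$ lie in this completion. *)

theory Defs
  imports "HOL-Library.FuncSet" "HOL-Library.Multiset" "HOL-Library.Product_Plus"
    "HOL-Library.Poly_Mapping"
begin

section \<open>Operadic trees\<close>

text \<open>
  A diagram of sets \<open>A \<leftarrow> M \<rightarrow> N \<rightarrow> A\<close>. The three structure maps are only
  meaningful on the carriers.
\<close>

record ('a, 'm, 'n) tree_diagram =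
  edges :: "'a set"
  marks :: "'m set"
  nodes :: "'n set"
  src :: "'m \<Rightarrow> 'a"
  node_of :: "'m \<Rightarrow> 'n"
  out :: "'n \<Rightarrow> 'a"

definition root :: "('a, 'm, 'n) tree_diagram \<Rightarrow> 'a" where
  "root T = (THE r. edges T - src T ` marks T = {r})"

text \<open>The walk-to-the-root map \<open>\<sigma>\<close>, with \<open>\<sigma> (s e) = t (p e)\<close>.\<close>

definition parent :: "('a, 'm, 'n) tree_diagram \<Rightarrow> 'a \<Rightarrow> 'a" where
  "parent T x =
     (if x = root T then x else out T (node_of T (inv_into (marks T) (src T) x)))"

definition operadic_tree :: "('a, 'm, 'n) tree_diagram \<Rightarrow> bool" where
  "operadic_tree T \<longleftrightarrow>
     finite (edges T) \<and> finite (marks T) \<and> finite (nodes T) \<and>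
     src T \<in> marks T \<rightarrow> edges T \<and> node_of T \<in> marks T \<rightarrow> nodes T \<and> out T \<in> nodes T \<rightarrow> edges T \<and>
     inj_on (out T) (nodes T) \<and> inj_on (src T) (marks T) \<and>
     (\<exists>r. edges T - src T ` marks T = {r}) \<and>
     (\<forall>x \<in> edges T. \<exists>k. (parent T ^^ k) x = root T)"

definition leaves :: "('a, 'm, 'n) tree_diagram \<Rightarrow> 'a set" where
  "leaves T = edges T - out T ` nodes T"

text \<open>
  Maps are taken extensional (undefined off the carriers), so that two embeddings are equal
  as triples exactly when they agree on the carriers. The last conjunct says that the square
  over \<open>p\<close> is a pullback.
\<close>

definition tree_embedding ::
  "('a, 'm, 'n) tree_diagram \<Rightarrow> ('b, 'k, 'l) tree_diagram \<Rightarrow>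
   ('a \<Rightarrow> 'b) \<times> ('m \<Rightarrow> 'k) \<times> ('n \<Rightarrow> 'l) \<Rightarrow> bool" where
  "tree_embedding S T = (\<lambda>(\<alpha>, \<mu>, \<nu>).
     \<alpha> \<in> edges S \<rightarrow>\<^sub>E edges T \<and> \<mu> \<in> marks S \<rightarrow>\<^sub>E marks T \<and> \<nu> \<in> nodes S \<rightarrow>\<^sub>E nodes T \<and>
     (\<forall>m \<in> marks S. \<alpha> (src S m) = src T (\<mu> m)) \<and>
     (\<forall>m \<in> marks S. \<nu> (node_of S m) = node_of T (\<mu> m)) \<and>
     (\<forall>n \<in> nodes S. \<alpha> (out S n) = out T (\<nu> n)) \<and>
     bij_betw (\<lambda>m. (node_of S m, \<mu> m)) (marks S)
       {(n, m). n \<in> nodes S \<and> m \<in> marks T \<and> \<nu> n = node_of T m})"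

definition tree_id ::
  "('a, 'm, 'n) tree_diagram \<Rightarrow> ('a \<Rightarrow> 'a) \<times> ('m \<Rightarrow> 'm) \<times> ('n \<Rightarrow> 'n)" where
  "tree_id T = (\<lambda>x\<in>edges T. x, \<lambda>x\<in>marks T. x, \<lambda>x\<in>nodes T. x)"

text \<open>\<open>tree_comp R g f\<close> is \<open>g \<circ> f\<close>, where \<open>f\<close> has domain \<open>R\<close>.\<close>

definition tree_comp ::
  "('a, 'm, 'n) tree_diagram \<Rightarrow> ('b \<Rightarrow> 'c) \<times> ('k \<Rightarrow> 'p) \<times> ('l \<Rightarrow> 'q) \<Rightarrow>
   ('a \<Rightarrow> 'b) \<times> ('m \<Rightarrow> 'k) \<times> ('n \<Rightarrow> 'l) \<Rightarrow> ('a \<Rightarrow> 'c) \<times> ('m \<Rightarrow> 'p) \<times> ('n \<Rightarrow> 'q)" where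
  "tree_comp R = (\<lambda>(\<alpha>', \<mu>', \<nu>') (\<alpha>, \<mu>, \<nu>).
     (compose (edges R) \<alpha>' \<alpha>, compose (marks R) \<mu>' \<mu>, compose (nodes R) \<nu>' \<nu>))"

definition tree_iso ::
  "('a, 'm, 'n) tree_diagram \<Rightarrow> ('b, 'k, 'l) tree_diagram \<Rightarrow>
   ('a \<Rightarrow> 'b) \<times> ('m \<Rightarrow> 'k) \<times> ('n \<Rightarrow> 'l) \<Rightarrow> bool" where
  "tree_iso S T f \<longleftrightarrow> tree_embedding S T f \<and>
     (\<exists>g. tree_embedding T S g \<and> tree_comp S g f = tree_id S \<and> tree_comp T f g = tree_id T)"

definition Aut :: "('a, 'm, 'n) tree_diagram \<Rightarrow> (('a \<Rightarrow> 'a) \<times> ('m \<Rightarrow> 'm) \<times> ('n \<Rightarrow> 'n)) set" where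
  "Aut T = {f. tree_iso T T f}"

text \<open>
  A subtree is given by its three sets of edges, marks and nodes; taking the structure maps of
  the subtree to be literally those of \<open>T\<close> makes every subtree occur exactly once.
\<close>

definition cuts :: "('a, 'm, 'n) tree_diagram \<Rightarrow> ('a, 'm, 'n) tree_diagram set" where
  "cuts T = {S. (\<exists>A M N. S = T\<lparr>edges := A, marks := M, nodes := N\<rparr> \<and>
     A \<subseteq> edges T \<and> M \<subseteq> marks T \<and> N \<subseteq> nodes T) \<and>
     operadic_tree S \<and> tree_embedding S T (tree_id S) \<and> root T \<in> edges S}"

definition ideal_edges :: "('a, 'm, 'n) tree_diagram \<Rightarrow> 'a \<Rightarrow> 'a set" where
  "ideal_edges T l = {x \<in> edges T. \<exists>k. (parent T ^^ k) x = l}"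

definition ideal_subtree :: "('a, 'm, 'n) tree_diagram \<Rightarrow> 'a \<Rightarrow> ('a, 'm, 'n) tree_diagram" where
  "ideal_subtree T l = T\<lparr>
     edges := ideal_edges T l,
     marks := {m \<in> marks T. out T (node_of T m) \<in> ideal_edges T l},
     nodes := {n \<in> nodes T. out T n \<in> ideal_edges T l}\<rparr>"


subsection \<open>Isomorphism classes\<close>

lemma tree_embedding_id: "operadic_tree T \<Longrightarrow> tree_embedding T T (tree_id T)"
  by (auto simp: tree_embedding_def tree_id_def operadic_tree_def bij_betw_def inj_on_def
      Pi_iff image_iff)

lemma tree_embedding_comp:
  assumes f: "tree_embedding R S f" and g: "tree_embedding S T g"
    and R: "operadic_tree R"
  shows "tree_embedding R T (tree_comp R g f)"
proof -
  obtain \<alpha> \<mu> \<nu> where f_eq: "f = (\<alpha>, \<mu>, \<nu>)" by (cases f) auto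
  obtain \<alpha>' \<mu>' \<nu>' where g_eq: "g = (\<alpha>', \<mu>', \<nu>')" by (cases g) auto
  have \<alpha>: "\<And>x. x \<in> edges R \<Longrightarrow> \<alpha> x \<in> edges S" and \<mu>: "\<And>x. x \<in> marks R \<Longrightarrow> \<mu> x \<in> marks S"
    and \<nu>: "\<And>x. x \<in> nodes R \<Longrightarrow> \<nu> x \<in> nodes S"
    and fs: "\<And>m. m \<in> marks R \<Longrightarrow> \<alpha> (src R m) = src S (\<mu> m)"
    and fp: "\<And>m. m \<in> marks R \<Longrightarrow> \<nu> (node_of R m) = node_of S (\<mu> m)"
    and ft: "\<And>n. n \<in> nodes R \<Longrightarrow> \<alpha> (out R n) = out S (\<nu> n)"
    and fb: "bij_betw (\<lambda>m. (node_of R m, \<mu> m)) (marks R)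
       {(n, m). n \<in> nodes R \<and> m \<in> marks S \<and> \<nu> n = node_of S m}"
    using f unfolding f_eq tree_embedding_def by (auto simp: PiE_iff)
  have \<alpha>': "\<And>x. x \<in> edges S \<Longrightarrow> \<alpha>' x \<in> edges T" and \<mu>': "\<And>x. x \<in> marks S \<Longrightarrow> \<mu>' x \<in> marks T"
    and \<nu>': "\<And>x. x \<in> nodes S \<Longrightarrow> \<nu>' x \<in> nodes T"
    and gs: "\<And>m. m \<in> marks S \<Longrightarrow> \<alpha>' (src S m) = src T (\<mu>' m)"
    and gp: "\<And>m. m \<in> marks S \<Longrightarrow> \<nu>' (node_of S m) = node_of T (\<mu>' m)"
    and gt: "\<And>n. n \<in> nodes S \<Longrightarrow> \<alpha>' (out S n) = out T (\<nu>' n)"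
    and gb: "bij_betw (\<lambda>m. (node_of S m, \<mu>' m)) (marks S)
       {(n, m). n \<in> nodes S \<and> m \<in> marks T \<and> \<nu>' n = node_of T m}"
    using g unfolding g_eq tree_embedding_def by (auto simp: PiE_iff)
  have Rs: "\<And>m. m \<in> marks R \<Longrightarrow> src R m \<in> edges R" and Rp: "\<And>m. m \<in> marks R \<Longrightarrow> node_of R m \<in> nodes R"
    and Rt: "\<And>n. n \<in> nodes R \<Longrightarrow> out R n \<in> edges R"
    using R by (auto simp: operadic_tree_def)
  have bij: "bij_betw (\<lambda>m. (node_of R m, compose (marks R) \<mu>' \<mu> m)) (marks R)
       {(n, m). n \<in> nodes R \<and> m \<in> marks T \<and> compose (nodes R) \<nu>' \<nu> n = node_of T m}"
    unfolding bij_betw_def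
  proof
    show "inj_on (\<lambda>m. (node_of R m, compose (marks R) \<mu>' \<mu> m)) (marks R)"
    proof (rule inj_onI)
      fix x y assume x: "x \<in> marks R" and y: "y \<in> marks R"
        and eq: "(node_of R x, compose (marks R) \<mu>' \<mu> x) = (node_of R y, compose (marks R) \<mu>' \<mu> y)"
      from eq x y have p: "node_of R x = node_of R y" and q: "\<mu>' (\<mu> x) = \<mu>' (\<mu> y)"
        by (auto simp: compose_eq)
      have "node_of S (\<mu> x) = node_of S (\<mu> y)" using fp[OF x] fp[OF y] p by simp
      with q have "\<mu> x = \<mu> y" using gb \<mu>[OF x] \<mu>[OF y] by (auto simp: bij_betw_def inj_on_def)
      with p show "x = y" using fb x y by (auto simp: bij_betw_def inj_on_def)
    qed
    show "(\<lambda>m. (node_of R m, compose (marks R) \<mu>' \<mu> m)) ` marks R =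
       {(n, m). n \<in> nodes R \<and> m \<in> marks T \<and> compose (nodes R) \<nu>' \<nu> n = node_of T m}" (is "?L = ?Q")
    proof
      show "?L \<subseteq> ?Q" using Rp \<mu> \<mu>' fp gp by (auto simp: compose_eq)
      show "?Q \<subseteq> ?L"
      proof
        fix z assume "z \<in> ?Q"
        then obtain n m where z: "z = (n, m)" and n: "n \<in> nodes R" and m: "m \<in> marks T"
          and nm: "\<nu>' (\<nu> n) = node_of T m" by (auto simp: compose_eq)
        have "(\<nu> n, m) \<in> {(n, m). n \<in> nodes S \<and> m \<in> marks T \<and> \<nu>' n = node_of T m}"
          using n m nm \<nu> by auto
        then have "(\<nu> n, m) \<in> (\<lambda>m. (node_of S m, \<mu>' m)) ` marks S" using gb by (auto simp: bij_betw_def)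
        then obtain m1 where m1: "m1 \<in> marks S" "\<nu> n = node_of S m1" "m = \<mu>' m1" by auto
        then have "(n, m1) \<in> (\<lambda>m. (node_of R m, \<mu> m)) ` marks R" using fb n by (auto simp: bij_betw_def)
        then obtain m2 where "m2 \<in> marks R" "n = node_of R m2" "m1 = \<mu> m2" by auto
        with m1 z show "z \<in> ?L" by (auto simp: compose_eq image_iff intro!: bexI[of _ m2])
      qed
    qed
  qed
  show ?thesis
    unfolding f_eq g_eq tree_embedding_def tree_comp_def
    using bij by (simp add: compose_eq PiE_iff \<alpha> \<mu> \<nu> \<alpha>' \<mu>' \<nu>' fs fp ft Rs Rp Rt
        flip: gs gp gt)
qed

lemma tree_iso_refl:
  assumes "operadic_tree T"
  shows "tree_iso T T (tree_id T)"
proof -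
  have "tree_comp T (tree_id T) (tree_id T) = tree_id T"
    by (simp add: tree_comp_def tree_id_def compose_def cong: restrict_cong)
  with tree_embedding_id[OF assms] show ?thesis unfolding tree_iso_def by blast
qed

lemma tree_comp_assoc_id:
  assumes f: "tree_embedding R S f" and g: "tree_embedding S T g"
    and g': "tree_embedding T S g'" and g'g: "tree_comp S g' g = tree_id S"
    and f'f: "tree_comp R f' f = tree_id R"
  shows "tree_comp R (tree_comp T f' g') (tree_comp R g f) = tree_id R"
proof -
  obtain \<alpha> \<mu> \<nu> where f_eq: "f = (\<alpha>, \<mu>, \<nu>)" by (cases f) auto
  obtain \<alpha>' \<mu>' \<nu>' where f'_eq: "f' = (\<alpha>', \<mu>', \<nu>')" by (cases f') auto
  obtain \<beta> \<kappa> \<tau> where g_eq: "g = (\<beta>, \<kappa>, \<tau>)" by (cases g) auto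
  obtain \<beta>' \<kappa>' \<tau>' where g'_eq: "g' = (\<beta>', \<kappa>', \<tau>')" by (cases g') auto
  have 1: "\<And>x. x \<in> edges R \<Longrightarrow> \<alpha> x \<in> edges S" "\<And>x. x \<in> marks R \<Longrightarrow> \<mu> x \<in> marks S"
    "\<And>x. x \<in> nodes R \<Longrightarrow> \<nu> x \<in> nodes S"
    using f unfolding f_eq tree_embedding_def by (auto simp: PiE_iff)
  have 2: "\<And>x. x \<in> edges S \<Longrightarrow> \<beta> x \<in> edges T" "\<And>x. x \<in> marks S \<Longrightarrow> \<kappa> x \<in> marks T"
    "\<And>x. x \<in> nodes S \<Longrightarrow> \<tau> x \<in> nodes T"
    using g unfolding g_eq tree_embedding_def by (auto simp: PiE_iff)
  have 3: "\<And>x. x \<in> edges S \<Longrightarrow> \<beta>' (\<beta> x) = x" "\<And>x. x \<in> marks S \<Longrightarrow> \<kappa>' (\<kappa> x) = x"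
    "\<And>x. x \<in> nodes S \<Longrightarrow> \<tau>' (\<tau> x) = x"
    using g'g unfolding g_eq g'_eq tree_comp_def tree_id_def compose_def
    by (auto simp: fun_eq_iff split: if_splits)
  have 4: "\<And>x. x \<in> edges R \<Longrightarrow> \<alpha>' (\<alpha> x) = x" "\<And>x. x \<in> marks R \<Longrightarrow> \<mu>' (\<mu> x) = x"
    "\<And>x. x \<in> nodes R \<Longrightarrow> \<nu>' (\<nu> x) = x"
    using f'f unfolding f_eq f'_eq tree_comp_def tree_id_def compose_def
    by (auto simp: fun_eq_iff split: if_splits)
  show ?thesis
    unfolding f_eq f'_eq g_eq g'_eq tree_comp_def tree_id_def compose_def
    by (simp add: 1 2 3 4 cong: restrict_cong)
qed

lemma tree_iso_trans:
  assumes R: "operadic_tree R" and S: "operadic_tree S" and T: "operadic_tree T"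
    and f: "tree_iso R S f" and g: "tree_iso S T g"
  shows "tree_iso R T (tree_comp R g f)"
proof -
  from f obtain f' where f': "tree_embedding R S f" "tree_embedding S R f'"
    "tree_comp R f' f = tree_id R" "tree_comp S f f' = tree_id S"
    unfolding tree_iso_def by blast
  from g obtain g' where g': "tree_embedding S T g" "tree_embedding T S g'"
    "tree_comp S g' g = tree_id S" "tree_comp T g g' = tree_id T"
    unfolding tree_iso_def by blast
  show ?thesis
    unfolding tree_iso_def
    using tree_embedding_comp[OF f'(1) g'(1) R] tree_embedding_comp[OF g'(2) f'(2) T]
      tree_comp_assoc_id[OF f'(1) g'(1,2,3) f'(3)] tree_comp_assoc_id[OF g'(2) f'(2,1,4) g'(4)]
    by blast
qed

definition tree_rel :: "('a, 'm, 'n) tree_diagram \<Rightarrow> ('a, 'm, 'n) tree_diagram \<Rightarrow> bool" where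
  "tree_rel S T \<longleftrightarrow> operadic_tree S \<and> operadic_tree T \<and> (\<exists>f. tree_iso S T f)"

lemma part_equivp_tree_rel: "part_equivp (tree_rel :: (nat, nat, nat) tree_diagram \<Rightarrow> _)"
proof (rule part_equivpI)
  let ?T = "\<lparr>edges = {0}, marks = {}, nodes = {}, src = id, node_of = id, out = id\<rparr>
    :: (nat, nat, nat) tree_diagram"
  have "root ?T = 0" by (auto simp: root_def)
  then have "operadic_tree ?T" by (auto simp: operadic_tree_def parent_def intro: exI[of _ 0])
  then show "\<exists>T :: (nat, nat, nat) tree_diagram. tree_rel T T"
    using tree_iso_refl unfolding tree_rel_def by blast
  show "symp (tree_rel :: (nat, nat, nat) tree_diagram \<Rightarrow> _)"
    unfolding symp_def tree_rel_def tree_iso_def by blast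
  show "transp (tree_rel :: (nat, nat, nat) tree_diagram \<Rightarrow> _)"
    by (rule transpI) (metis tree_rel_def tree_iso_trans)
qed

text \<open>
  Every operadic tree is isomorphic to one whose carriers are finite sets of natural numbers
  (\<open>operadic_tree_nat_model\<close> below), so this type is the set of all isomorphism classes of operadic trees.
\<close>

quotient_type tree_class = "(nat, nat, nat) tree_diagram" / partial: tree_rel
  by (rule part_equivp_tree_rel)

abbreviation class_of :: "(nat, nat, nat) tree_diagram \<Rightarrow> tree_class" where
  "class_of \<equiv> abs_tree_class"

abbreviation rep :: "tree_class \<Rightarrow> (nat, nat, nat) tree_diagram" where
  "rep \<equiv> rep_tree_class"

lemma tree_rel_rep_class_of: "operadic_tree T \<Longrightarrow> tree_rel (rep (class_of T)) T"
  using Quotient_rep_abs[OF Quotient_tree_class] tree_iso_refl unfolding tree_rel_def by blast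

lemma operadic_tree_rep: "operadic_tree (rep X)"
  using Quotient_rep_reflp[OF Quotient_tree_class] by (simp add: tree_rel_def)


section \<open>The bialgebra and its completion\<close>

type_synonym forest = "tree_class multiset"

text \<open>
  A forest is the monomial of its trees, so the polynomial algebra is the monoid algebra of
  the forests, its tensor square is the monoid algebra of the pairs of forests (with
  \<open>P \<otimes> S\<close> the basis element \<open>(P, S)\<close>), and both inherit their multiplication from
  \<^theory>\<open>HOL-Library.Poly_Mapping\<close>. In the completions all families of coefficients are allowed.
\<close>

type_synonym 'k tree_algebra = "forest \<Rightarrow>\<^sub>0 'k"
type_synonym 'k tree_algebra2 = "(forest \<times> forest) \<Rightarrow>\<^sub>0 'k"
type_synonym 'k tree_series = "forest \<Rightarrow> 'k"
type_synonym 'k tree_series2 = "forest \<times> forest \<Rightarrow> 'k"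

abbreviation coeff :: "('x \<Rightarrow>\<^sub>0 'k::zero) \<Rightarrow> 'x \<Rightarrow> 'k" where
  "coeff \<equiv> Poly_Mapping.lookup"

abbreviation monomial :: "'x \<Rightarrow> ('x \<Rightarrow>\<^sub>0 'k::{zero,one})" where
  "monomial m \<equiv> Poly_Mapping.single m 1"

abbreviation generator :: "tree_class \<Rightarrow> 'k::{zero,one} tree_algebra" where
  "generator X \<equiv> monomial {#X#}"

text \<open>The forest \<open>P\<^sub>c\<close> of the cut \<open>S\<close> of \<open>T\<close>.\<close>

definition pruned :: "(nat, nat, nat) tree_diagram \<Rightarrow> (nat, nat, nat) tree_diagram \<Rightarrow> forest" where
  "pruned T S = image_mset (\<lambda>l. class_of (ideal_subtree T l)) (mset_set (leaves S))"

definition comult_tree :: "tree_class \<Rightarrow> 'k::comm_ring_1 tree_algebra2" where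
  "comult_tree X = (\<Sum>S \<in> cuts (rep X). monomial (pruned (rep X) S, {#class_of S#}))"

text \<open>
  The unique algebra map with the values \<open>comult_tree X\<close> on the generators; see
  \<open>comult_add\<close>, \<open>comult_mult\<close> and \<open>comult_generator\<close> below.
\<close>

definition comult :: "'k::comm_ring_1 tree_algebra \<Rightarrow> 'k tree_algebra2" where
  "comult f = (\<Sum>m \<in> Poly_Mapping.keys f. Poly_Mapping.single 0 (coeff f m) * (\<Prod>X\<in>#m. comult_tree X))"

text \<open>
  Infinite sums in the completions: a family is summable iff every coefficient is nonzero for
  only finitely many members, and the sum is then formed coefficientwise.
\<close>

definition has_formal_sum ::
  "('i \<Rightarrow> 'x \<Rightarrow> 'k::comm_monoid_add) \<Rightarrow> ('x \<Rightarrow> 'k) \<Rightarrow> 'i set \<Rightarrow> bool"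
    (infixr \<open>has'_formal'_sum\<close> 46) where
  "(F has_formal_sum s) I \<longleftrightarrow>
     (\<forall>x. finite {i \<in> I. F i x \<noteq> 0} \<and> s x = (\<Sum>i | i \<in> I \<and> F i x \<noteq> 0. F i x))"

definition formal_sum :: "('i \<Rightarrow> 'x \<Rightarrow> 'k::comm_monoid_add) \<Rightarrow> 'i set \<Rightarrow> 'x \<Rightarrow> 'k" where
  "formal_sum F I = (\<lambda>x. \<Sum>i | i \<in> I \<and> F i x \<noteq> 0. F i x)"

text \<open>
  The extension of the comultiplication to series. Its defining sum is always summable, see
  \<open>comult_hat_has_formal_sum\<close> below.
\<close>

definition comult_hat :: "'k::comm_ring_1 tree_series \<Rightarrow> 'k tree_series2" where
  "comult_hat f = formal_sum (\<lambda>m z. f m * coeff (comult (monomial m)) z) UNIV"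

definition series_mult :: "'k::comm_ring_1 tree_series \<Rightarrow> 'k tree_series \<Rightarrow> 'k tree_series" where
  "series_mult f g = (\<lambda>m. \<Sum>(a, b) | a + b = m. f a * g b)"

primrec series_power :: "'k::comm_ring_1 tree_series \<Rightarrow> nat \<Rightarrow> 'k tree_series" where
  "series_power f 0 = coeff (monomial {#})"
| "series_power f (Suc n) = series_mult f (series_power f n)"

definition tensor :: "'k::comm_ring_1 tree_series \<Rightarrow> 'k tree_series \<Rightarrow> 'k tree_series2"
    (infixr \<open>\<otimes>\<close> 70) where
  "f \<otimes> g = (\<lambda>(a, b). f a * g b)"

definition green_term :: "tree_class \<Rightarrow> 'k::field_char_0 tree_series" where
  "green_term X = (\<lambda>m. coeff (generator X) m / of_nat (card (Aut (rep X))))"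

definition green :: "'k::field_char_0 tree_series" where
  "green = formal_sum green_term UNIV"

definition green_leaves :: "nat \<Rightarrow> 'k::field_char_0 tree_series" where
  "green_leaves n = formal_sum green_term {X. card (leaves (rep X)) = n}"


section \<open>Well-definedness\<close>

lemma root_eqI: "edges T - src T ` marks T = {r} \<Longrightarrow> root T = r"
  by (simp add: root_def)

lemma operadic_tree_root:
  assumes "operadic_tree T"
  shows "edges T - src T ` marks T = {root T}"
proof -
  obtain r where "edges T - src T ` marks T = {r}"
    using assms by (auto simp only: operadic_tree_def)
  with root_eqI[OF this] show ?thesis by simp
qed

lemma parent_root [simp]: "parent T (root T) = root T"
  by (simp add: parent_def)

lemma parent_funpow_root [simp]: "(parent T ^^ k) (root T) = root T"
  by (induction k) auto

lemma parent_src: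
  assumes "inj_on (src T) (marks T)" "edges T - src T ` marks T = {root T}" "m \<in> marks T"
  shows "parent T (src T m) = out T (node_of T m)"
  using assms by (auto simp: parent_def)

lemma operadic_tree_edge_cases:
  assumes T: "operadic_tree T" and x: "x \<in> edges T"
  obtains "x = root T" | m where "m \<in> marks T" "x = src T m" "parent T x = out T (node_of T m)"
proof (cases "x \<in> src T ` marks T")
  case False
  then have "x \<in> edges T - src T ` marks T" using x by simp
  then have "x = root T" using operadic_tree_root[OF T] by simp
  then show ?thesis by (rule that(1))
next
  case True
  then obtain m where m: "m \<in> marks T" "x = src T m" by blast
  have "inj_on (src T) (marks T)" using T by (simp add: operadic_tree_def)
  from parent_src[OF this operadic_tree_root[OF T] m(1)] m show ?thesis by (intro that(2)) simp_all
qed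

lemma operadic_tree_parent_in:
  assumes T: "operadic_tree T" and x: "x \<in> edges T"
  shows "parent T x \<in> edges T"
  using operadic_tree_edge_cases[OF T x]
proof cases
  case 1
  with x show ?thesis by simp
next
  case (2 m)
  with T show ?thesis by (auto simp: operadic_tree_def Pi_iff)
qed

lemma tree_embedding_bijI:
  assumes bij: "bij_betw \<alpha> (edges S) (edges T)" "bij_betw \<mu> (marks S) (marks T)"
      "bij_betw \<nu> (nodes S) (nodes T)"
    and s: "\<And>m. m \<in> marks S \<Longrightarrow> src S m \<in> edges S \<and> \<alpha> (src S m) = src T (\<mu> m)"
    and p: "\<And>m. m \<in> marks S \<Longrightarrow> node_of S m \<in> nodes S \<and> \<nu> (node_of S m) = node_of T (\<mu> m)"
    and t: "\<And>n. n \<in> nodes S \<Longrightarrow> out S n \<in> edges S \<and> \<alpha> (out S n) = out T (\<nu> n)"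
  shows "tree_embedding S T (\<lambda>x\<in>edges S. \<alpha> x, \<lambda>x\<in>marks S. \<mu> x, \<lambda>x\<in>nodes S. \<nu> x)"
proof -
  have \<alpha>: "\<And>x. x \<in> edges S \<Longrightarrow> \<alpha> x \<in> edges T" and \<mu>: "\<And>x. x \<in> marks S \<Longrightarrow> \<mu> x \<in> marks T"
    and \<nu>: "\<And>x. x \<in> nodes S \<Longrightarrow> \<nu> x \<in> nodes T"
    using bij by (meson bij_betwE)+
  have inj: "inj_on \<mu> (marks S)" "inj_on \<nu> (nodes S)" using bij by (auto simp: bij_betw_def)
  have "bij_betw (\<lambda>m. (node_of S m, (\<lambda>x\<in>marks S. \<mu> x) m)) (marks S)
       {(n, m). n \<in> nodes S \<and> m \<in> marks T \<and> (\<lambda>x\<in>nodes S. \<nu> x) n = node_of T m}" (is "bij_betw ?h _ ?Q")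
    unfolding bij_betw_def
  proof (intro conjI subset_antisym subsetI)
    show "inj_on ?h (marks S)"
      by (rule inj_onI) (use inj(1) in \<open>simp add: inj_onD\<close>)
  next
    fix z assume "z \<in> ?h ` marks S"
    then show "z \<in> ?Q" using p \<mu> by force
  next
    fix z assume "z \<in> ?Q"
    then obtain n m where z: "z = (n, m)" "n \<in> nodes S" "m \<in> marks T" "\<nu> n = node_of T m" by auto
    from z(3) bij(2) obtain m' where m': "m' \<in> marks S" "m = \<mu> m'" by (auto simp: bij_betw_def)
    then have "\<nu> n = \<nu> (node_of S m')" using z(4) p by simp
    then have "n = node_of S m'" using inj(2) z(2) p m'(1) by (meson inj_onD)
    with z m' show "z \<in> ?h ` marks S" by (intro image_eqI[of _ _ m']) simp_all
  qed
  then show ?thesis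
    unfolding tree_embedding_def using \<alpha> \<mu> \<nu> s p t by simp
qed

lemma tree_iso_bijI:
  assumes bij: "bij_betw \<alpha> (edges S) (edges T)" "bij_betw \<mu> (marks S) (marks T)"
      "bij_betw \<nu> (nodes S) (nodes T)"
    and s: "\<And>m. m \<in> marks S \<Longrightarrow> src S m \<in> edges S \<and> \<alpha> (src S m) = src T (\<mu> m)"
    and p: "\<And>m. m \<in> marks S \<Longrightarrow> node_of S m \<in> nodes S \<and> \<nu> (node_of S m) = node_of T (\<mu> m)"
    and t: "\<And>n. n \<in> nodes S \<Longrightarrow> out S n \<in> edges S \<and> \<alpha> (out S n) = out T (\<nu> n)"
  shows "tree_iso S T (\<lambda>x\<in>edges S. \<alpha> x, \<lambda>x\<in>marks S. \<mu> x, \<lambda>x\<in>nodes S. \<nu> x)" (is "tree_iso S T ?f")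
proof -
  let ?\<alpha> = "inv_into (edges S) \<alpha>" and ?\<mu> = "inv_into (marks S) \<mu>" and ?\<nu> = "inv_into (nodes S) \<nu>"
  let ?g = "(\<lambda>x\<in>edges T. ?\<alpha> x, \<lambda>x\<in>marks T. ?\<mu> x, \<lambda>x\<in>nodes T. ?\<nu> x)"
  have inv: "\<And>x. x \<in> edges S \<Longrightarrow> ?\<alpha> (\<alpha> x) = x" "\<And>x. x \<in> marks S \<Longrightarrow> ?\<mu> (\<mu> x) = x"
    "\<And>x. x \<in> nodes S \<Longrightarrow> ?\<nu> (\<nu> x) = x"
    "\<And>x. x \<in> edges T \<Longrightarrow> \<alpha> (?\<alpha> x) = x" "\<And>x. x \<in> marks T \<Longrightarrow> \<mu> (?\<mu> x) = x"
    "\<And>x. x \<in> nodes T \<Longrightarrow> \<nu> (?\<nu> x) = x"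
    using bij by (simp_all add: bij_betw_inv_into_left bij_betw_inv_into_right)
  have im: "\<And>x. x \<in> edges S \<Longrightarrow> \<alpha> x \<in> edges T" "\<And>x. x \<in> marks S \<Longrightarrow> \<mu> x \<in> marks T"
    "\<And>x. x \<in> nodes S \<Longrightarrow> \<nu> x \<in> nodes T"
    "\<And>x. x \<in> edges T \<Longrightarrow> ?\<alpha> x \<in> edges S" "\<And>x. x \<in> marks T \<Longrightarrow> ?\<mu> x \<in> marks S"
    "\<And>x. x \<in> nodes T \<Longrightarrow> ?\<nu> x \<in> nodes S"
    using bij bij_betw_inv_into by (meson bij_betwE)+
  have "tree_embedding T S ?g"
  proof (rule tree_embedding_bijI)
    show "bij_betw ?\<alpha> (edges T) (edges S)" "bij_betw ?\<mu> (marks T) (marks S)"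
      "bij_betw ?\<nu> (nodes T) (nodes S)"
      using bij bij_betw_inv_into by blast+
    show "src T m \<in> edges T \<and> ?\<alpha> (src T m) = src S (?\<mu> m)" if "m \<in> marks T" for m
      using s[OF im(5)[OF that]] inv(5)[OF that] inv(1) im(1) by metis
    show "node_of T m \<in> nodes T \<and> ?\<nu> (node_of T m) = node_of S (?\<mu> m)" if "m \<in> marks T" for m
      using p[OF im(5)[OF that]] inv(5)[OF that] inv(3) im(3) by metis
    show "out T n \<in> edges T \<and> ?\<alpha> (out T n) = out S (?\<nu> n)" if "n \<in> nodes T" for n
      using t[OF im(6)[OF that]] inv(6)[OF that] inv(1) im(1) by metis
  qed
  moreover have "tree_embedding S T ?f" using tree_embedding_bijI[OF assms] by blast
  moreover have "tree_comp S ?g ?f = tree_id S" "tree_comp T ?f ?g = tree_id T"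
    by (simp_all add: tree_comp_def tree_id_def compose_def inv im cong: restrict_cong)
  ultimately show ?thesis unfolding tree_iso_def by blast
qed

definition transport ::
  "('a \<Rightarrow> 'b) \<Rightarrow> ('m \<Rightarrow> 'k) \<Rightarrow> ('n \<Rightarrow> 'l) \<Rightarrow> ('a, 'm, 'n) tree_diagram \<Rightarrow> ('b, 'k, 'l) tree_diagram" where
  "transport \<alpha> \<mu> \<nu> T = \<lparr>edges = \<alpha> ` edges T, marks = \<mu> ` marks T, nodes = \<nu> ` nodes T,
     src = (\<lambda>m\<in>\<mu> ` marks T. \<alpha> (src T (inv_into (marks T) \<mu> m))),
     node_of = (\<lambda>m\<in>\<mu> ` marks T. \<nu> (node_of T (inv_into (marks T) \<mu> m))),
     out = (\<lambda>n\<in>\<nu> ` nodes T. \<alpha> (out T (inv_into (nodes T) \<nu> n)))\<rparr>"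

lemma operadic_transport:
  fixes \<alpha> :: "'a \<Rightarrow> 'b" and \<mu> :: "'m \<Rightarrow> 'k" and \<nu> :: "'n \<Rightarrow> 'l"
  assumes T: "operadic_tree T"
    and \<alpha>: "inj_on \<alpha> (edges T)" and \<mu>: "inj_on \<mu> (marks T)" and \<nu>: "inj_on \<nu> (nodes T)"
  defines "T' \<equiv> transport \<alpha> \<mu> \<nu> T"
  shows "operadic_tree T'" "\<exists>f. tree_iso T T' f"
proof -
  have fin: "finite (edges T)" "finite (marks T)" "finite (nodes T)"
    and s: "\<And>m. m \<in> marks T \<Longrightarrow> src T m \<in> edges T" and p: "\<And>m. m \<in> marks T \<Longrightarrow> node_of T m \<in> nodes T"
    and t: "\<And>n. n \<in> nodes T \<Longrightarrow> out T n \<in> edges T"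
    and injt: "inj_on (out T) (nodes T)" and injs: "inj_on (src T) (marks T)"
    and reach: "\<And>x. x \<in> edges T \<Longrightarrow> \<exists>k. (parent T ^^ k) x = root T"
    using T unfolding operadic_tree_def by auto
  note r = operadic_tree_root[OF T]
  have carr [simp]: "edges T' = \<alpha> ` edges T" "marks T' = \<mu> ` marks T" "nodes T' = \<nu> ` nodes T"
    by (simp_all add: T'_def transport_def)
  have s' [simp]: "src T' (\<mu> m) = \<alpha> (src T m)" and p' [simp]: "node_of T' (\<mu> m) = \<nu> (node_of T m)"
    if "m \<in> marks T" for m
    using that \<mu> by (auto simp: T'_def transport_def)
  have t' [simp]: "out T' (\<nu> n) = \<alpha> (out T n)" if "n \<in> nodes T" for n
    using that \<nu> by (auto simp: T'_def transport_def)
  have injs': "inj_on (src T') (marks T')"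
  proof (rule inj_onI)
    fix x y assume "x \<in> marks T'" "y \<in> marks T'" and eq: "src T' x = src T' y"
    then obtain m m' where m: "x = \<mu> m" "y = \<mu> m'" "m \<in> marks T" "m' \<in> marks T" by auto
    with eq have "\<alpha> (src T m) = \<alpha> (src T m')" by simp
    with m \<alpha> s injs show "x = y" by (metis inj_onD)
  qed
  have injt': "inj_on (out T') (nodes T')"
  proof (rule inj_onI)
    fix x y assume "x \<in> nodes T'" "y \<in> nodes T'" and eq: "out T' x = out T' y"
    then obtain n n' where n: "x = \<nu> n" "y = \<nu> n'" "n \<in> nodes T" "n' \<in> nodes T" by auto
    with eq have "\<alpha> (out T n) = \<alpha> (out T n')" by simp
    with n \<alpha> t injt show "x = y" by (metis inj_onD)
  qed
  have "src T' ` marks T' = \<alpha> ` (src T ` marks T)" by (force simp: image_iff)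
  then have "edges T' - src T' ` marks T' = \<alpha> ` (edges T - src T ` marks T)"
    using inj_on_image_set_diff[OF \<alpha>, of "edges T" "src T ` marks T"] s by auto
  then have r': "edges T' - src T' ` marks T' = {\<alpha> (root T)}" using r by simp
  then have root': "root T' = \<alpha> (root T)" by (rule root_eqI)
  have par: "parent T' (\<alpha> x) = \<alpha> (parent T x)" if x: "x \<in> edges T" for x
    using operadic_tree_edge_cases[OF T x]
  proof cases
    case 1
    then have "parent T' (\<alpha> x) = \<alpha> x" using root' parent_root[of T'] by simp
    with 1 show ?thesis by simp
  next
    case (2 m)
    have "parent T' (src T' (\<mu> m)) = out T' (node_of T' (\<mu> m))"
      using parent_src[of T' "\<mu> m"] injs' r' root' 2 by simp
    then have "parent T' (\<alpha> (src T m)) = \<alpha> (out T (node_of T m))" using 2(1) p by simp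
    then show ?thesis using 2(2,3) by simp
  qed
  have in_edges: "(parent T ^^ k) x \<in> edges T" if "x \<in> edges T" for k x
    using that operadic_tree_parent_in[OF T] by (induction k) auto
  have par': "(parent T' ^^ k) (\<alpha> x) = \<alpha> ((parent T ^^ k) x)" if "x \<in> edges T" for k x
    using that in_edges par by (induction k) auto
  show "operadic_tree T'"
    unfolding operadic_tree_def
  proof (intro conjI)
    show "\<forall>x\<in>edges T'. \<exists>k. (parent T' ^^ k) x = root T'"
      using par' reach root' by (metis carr(1) imageE)
  qed (use fin s p t injs' injt' r' in auto)
  have "tree_iso T T' (\<lambda>x\<in>edges T. \<alpha> x, \<lambda>x\<in>marks T. \<mu> x, \<lambda>x\<in>nodes T. \<nu> x)"
    by (rule tree_iso_bijI) (use \<alpha> \<mu> \<nu> s p t in \<open>simp_all add: bij_betw_def\<close>)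
  then show "\<exists>f. tree_iso T T' f" by blast
qed

lemma operadic_tree_card:
  assumes "operadic_tree T"
  shows "card (marks T) \<le> card (edges T)" "card (nodes T) \<le> card (edges T)" "card (edges T) > 0"
  using assms operadic_tree_root[OF assms] unfolding operadic_tree_def
  by (auto intro: card_inj_on_le[of "src T"] card_inj_on_le[of "out T"] simp: card_gt_0_iff)

definition bounded_trees :: "nat \<Rightarrow> (nat, nat, nat) tree_diagram set" where
  "bounded_trees k = {T. edges T \<subseteq> {..<k} \<and> marks T \<subseteq> {..<k} \<and> nodes T \<subseteq> {..<k} \<and>
     src T \<in> marks T \<rightarrow>\<^sub>E {..<k} \<and> node_of T \<in> marks T \<rightarrow>\<^sub>E {..<k} \<and> out T \<in> nodes T \<rightarrow>\<^sub>E {..<k}}"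

lemma finite_bounded_trees: "finite (bounded_trees k)"
proof -
  let ?P = "Pow {..<k}" and ?F = "\<Union>M\<in>Pow {..<k}. M \<rightarrow>\<^sub>E {..<k}"
  have "bounded_trees k \<subseteq>
    (\<lambda>(A, M, N, s, p, t). \<lparr>edges = A, marks = M, nodes = N, src = s, node_of = p, out = t\<rparr>) `
      (?P \<times> ?P \<times> ?P \<times> ?F \<times> ?F \<times> ?F)"
  proof
    fix T assume T: "T \<in> bounded_trees k"
    show "T \<in> (\<lambda>(A, M, N, s, p, t). \<lparr>edges = A, marks = M, nodes = N, src = s, node_of = p, out = t\<rparr>) `
      (?P \<times> ?P \<times> ?P \<times> ?F \<times> ?F \<times> ?F)"
      by (rule image_eqI[of _ _ "(edges T, marks T, nodes T, src T, node_of T, out T)"])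
        (use T in \<open>auto simp: bounded_trees_def\<close>)
  qed
  moreover have "finite ?F"
    by (rule finite_UN_I) (auto intro: finite_PiE finite_subset)
  then have "finite (?P \<times> ?P \<times> ?P \<times> ?F \<times> ?F \<times> ?F)"
    by (intro finite_cartesian_product) simp_all
  ultimately show ?thesis by (rule finite_subset[OF _ finite_imageI])
qed

lemma ex_inj_bounded:
  assumes "finite A" "card A \<le> k"
  shows "\<exists>h::'a \<Rightarrow> nat. inj_on h A \<and> h ` A \<subseteq> {..<k}"
proof -
  obtain h where "bij_betw h A {0..<card A}" using ex_bij_betw_finite_nat[OF assms(1)] by blast
  with assms(2) show ?thesis by (intro exI[of _ h]) (auto simp: bij_betw_def)
qed

lemma operadic_tree_nat_model:
  fixes T :: "('a, 'm, 'n) tree_diagram"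
  assumes T: "operadic_tree T" and k: "card (edges T) \<le> k"
  obtains T' f where "operadic_tree T'" "T' \<in> bounded_trees k" "tree_iso T T' f"
proof -
  have fin: "finite (edges T)" "finite (marks T)" "finite (nodes T)"
    using T by (auto simp: operadic_tree_def)
  obtain \<alpha> :: "'a \<Rightarrow> nat" where \<alpha>: "inj_on \<alpha> (edges T)" "\<alpha> ` edges T \<subseteq> {..<k}"
    using ex_inj_bounded[OF fin(1) k] by blast
  obtain \<mu> :: "'m \<Rightarrow> nat" where \<mu>: "inj_on \<mu> (marks T)" "\<mu> ` marks T \<subseteq> {..<k}"
    using ex_inj_bounded[OF fin(2) order_trans[OF operadic_tree_card(1)[OF T] k]] by blast
  obtain \<nu> :: "'n \<Rightarrow> nat" where \<nu>: "inj_on \<nu> (nodes T)" "\<nu> ` nodes T \<subseteq> {..<k}"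
    using ex_inj_bounded[OF fin(3) order_trans[OF operadic_tree_card(2)[OF T] k]] by blast
  from operadic_transport(2)[OF T \<alpha>(1) \<mu>(1) \<nu>(1)]
  obtain f where f: "tree_iso T (transport \<alpha> \<mu> \<nu> T) f" ..
  have "transport \<alpha> \<mu> \<nu> T \<in> bounded_trees k"
    using \<alpha> \<mu> \<nu> T unfolding bounded_trees_def operadic_tree_def transport_def
    by (simp add: PiE_iff image_subset_iff Pi_iff)
  with f operadic_transport(1)[OF T \<alpha>(1) \<mu>(1) \<nu>(1)] show ?thesis by (intro that)
qed

definition tree_size :: "tree_class \<Rightarrow> nat" where
  "tree_size X = card (edges (rep X))"

lemma tree_size_pos: "tree_size X > 0"
  using operadic_tree_card(3)[OF operadic_tree_rep] by (simp add: tree_size_def)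

lemma tree_iso_bij:
  assumes "tree_iso S T f"
  shows "bij_betw (fst f) (edges S) (edges T)"
proof -
  obtain g where g: "tree_embedding S T f" "tree_embedding T S g"
    "tree_comp S g f = tree_id S" "tree_comp T f g = tree_id T"
    using assms unfolding tree_iso_def by blast
  show ?thesis
  proof (rule bij_betw_byWitness[where f' = "fst g"])
    show "\<forall>a\<in>edges S. fst g (fst f a) = a" "\<forall>a\<in>edges T. fst f (fst g a) = a"
      using g(3,4) by (auto simp: tree_comp_def tree_id_def compose_def fun_eq_iff split: prod.splits if_splits)
    show "fst f ` edges S \<subseteq> edges T" "fst g ` edges T \<subseteq> edges S"
      using g(1,2) by (auto simp: tree_embedding_def split: prod.splits)
  qed
qed

lemma tree_size_class_of: "operadic_tree T \<Longrightarrow> tree_size (class_of T) = card (edges T)"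
  using tree_rel_rep_class_of[of T] tree_iso_bij bij_betw_same_card
  unfolding tree_rel_def tree_size_def by blast

lemma finite_tree_size_le: "finite {X. tree_size X \<le> k}"
proof -
  have "{X. tree_size X \<le> k} \<subseteq> class_of ` bounded_trees k"
  proof
    fix X assume "X \<in> {X. tree_size X \<le> k}"
    then have "card (edges (rep X)) \<le> k" by (simp add: tree_size_def)
    from operadic_tree_nat_model[OF operadic_tree_rep this]
    obtain T' f where T': "operadic_tree T'" "T' \<in> bounded_trees k" "tree_iso (rep X) T' f" .
    then have "tree_rel (rep X) T'" using operadic_tree_rep unfolding tree_rel_def by blast
    then have "class_of T' = X"
      using Quotient_rel_abs[OF Quotient_tree_class] Quotient_abs_rep[OF Quotient_tree_class] by metis
    with T' show "X \<in> class_of ` bounded_trees k" by blast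
  qed
  then show ?thesis using finite_bounded_trees finite_subset by blast
qed

lemma finite_cuts:
  assumes "operadic_tree T"
  shows "finite (cuts T)"
proof (rule finite_subset)
  show "cuts T \<subseteq> (\<lambda>(A, M, N). T\<lparr>edges := A, marks := M, nodes := N\<rparr>) `
    (Pow (edges T) \<times> Pow (marks T) \<times> Pow (nodes T))"
  proof
    fix S assume "S \<in> cuts T"
    then obtain A M N where "S = T\<lparr>edges := A, marks := M, nodes := N\<rparr>"
      "A \<subseteq> edges T" "M \<subseteq> marks T" "N \<subseteq> nodes T"
      unfolding cuts_def by blast
    then show "S \<in> (\<lambda>(A, M, N). T\<lparr>edges := A, marks := M, nodes := N\<rparr>) `
      (Pow (edges T) \<times> Pow (marks T) \<times> Pow (nodes T))"
      by (intro image_eqI[of _ _ "(A, M, N)"]) auto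
  qed
qed (use assms in \<open>auto simp: operadic_tree_def\<close>)

lemma operadic_tree_ideal_subtree:
  assumes T: "operadic_tree T" and l: "l \<in> edges T"
  shows "operadic_tree (ideal_subtree T l)" "root (ideal_subtree T l) = l"
proof -
  let ?I = "ideal_subtree T l"
  have fin: "finite (edges T)" "finite (marks T)" "finite (nodes T)"
    and s: "\<And>m. m \<in> marks T \<Longrightarrow> src T m \<in> edges T" and p: "\<And>m. m \<in> marks T \<Longrightarrow> node_of T m \<in> nodes T"
    and t: "\<And>n. n \<in> nodes T \<Longrightarrow> out T n \<in> edges T"
    and injt: "inj_on (out T) (nodes T)" and injs: "inj_on (src T) (marks T)"
    and reach: "\<And>x. x \<in> edges T \<Longrightarrow> \<exists>k. (parent T ^^ k) x = root T"
    using T unfolding operadic_tree_def by auto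
  note r = operadic_tree_root[OF T]
  have ps: "parent T (src T m) = out T (node_of T m)" if "m \<in> marks T" for m
    using parent_src[OF injs r that] .
  have carr: "edges ?I = ideal_edges T l"
    "marks ?I = {m \<in> marks T. out T (node_of T m) \<in> ideal_edges T l}"
    "nodes ?I = {n \<in> nodes T. out T n \<in> ideal_edges T l}"
    "src ?I = src T" "node_of ?I = node_of T" "out ?I = out T"
    by (simp_all add: ideal_subtree_def)
  have sin: "src T m \<in> ideal_edges T l" if m: "m \<in> marks T" "out T (node_of T m) \<in> ideal_edges T l" for m
  proof -
    from m obtain k where "(parent T ^^ k) (parent T (src T m)) = l"
      using ps by (auto simp: ideal_edges_def)
    then have "(parent T ^^ Suc k) (src T m) = l" by (simp add: funpow_swap1)
    with s m show ?thesis unfolding ideal_edges_def by blast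
  qed
  have lin: "l \<in> ideal_edges T l" using l by (auto simp: ideal_edges_def intro: exI[of _ 0])
  have nocyc: "l = root T" if "(parent T ^^ Suc k) l = l" for k
  proof -
    obtain j where j: "(parent T ^^ j) l = root T" using reach l by blast
    have cyc: "(parent T ^^ (Suc k * i)) l = l" for i
    proof (induction i)
      case (Suc i)
      have "(parent T ^^ (Suc k * Suc i)) l = (parent T ^^ Suc k) ((parent T ^^ (Suc k * i)) l)"
        by (simp only: mult_Suc_right funpow_add comp_apply)
      also have "\<dots> = l" by (simp only: Suc.IH that)
      finally show ?case .
    qed simp
    have "Suc k * j = (k * j) + j" by simp
    then have "(parent T ^^ (Suc k * j)) l = (parent T ^^ (k * j)) ((parent T ^^ j) l)"
      by (simp only: funpow_add comp_apply)
    with cyc[of j] j show ?thesis by simp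
  qed
  have lnot: "l \<notin> src T ` marks ?I"
  proof
    assume "l \<in> src T ` marks ?I"
    then obtain m where m: "m \<in> marks T" "l = src T m" "out T (node_of T m) \<in> ideal_edges T l"
      using carr by auto
    then obtain k where "(parent T ^^ k) (parent T l) = l"
      using ps by (auto simp: ideal_edges_def)
    then have "l = root T" using nocyc[of k] by (simp add: funpow_swap1)
    with m r show False by auto
  qed
  have step: "\<exists>m \<in> marks ?I. x = src T m" if x: "x \<in> ideal_edges T l" "x \<noteq> l" for x
  proof -
    from x obtain k where xT: "x \<in> edges T" and k: "(parent T ^^ k) x = l"
      by (auto simp: ideal_edges_def)
    with x(2) obtain k' where k': "k = Suc k'" by (cases k) auto
    have "x \<noteq> root T" using k x(2) by auto
    then obtain m where m: "m \<in> marks T" "x = src T m" "parent T x = out T (node_of T m)"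
      using operadic_tree_edge_cases[OF T xT] by metis
    have "(parent T ^^ k') (parent T x) = l" using k k' by (simp add: funpow_swap1)
    with operadic_tree_parent_in[OF T xT] have "parent T x \<in> ideal_edges T l"
      by (auto simp: ideal_edges_def)
    with m carr show ?thesis by auto
  qed
  have rI: "edges ?I - src ?I ` marks ?I = {l}"
    using step lin lnot carr by auto
  then show rootI: "root ?I = l" by (rule root_eqI)
  have injsI: "inj_on (src ?I) (marks ?I)" using injs carr by (auto simp: inj_on_def)
  have reachI: "\<exists>j. (parent ?I ^^ j) x = l" if "(parent T ^^ k) x = l" "x \<in> edges T" for k x
    using that
  proof (induction k arbitrary: x)
    case 0
    then show ?case by (auto intro: exI[of _ 0])
  next
    case (Suc k)
    show ?case
    proof (cases "x = l")
      case True
      then show ?thesis by (auto intro: exI[of _ 0])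
    next
      case False
      have "x \<in> ideal_edges T l" using Suc.prems unfolding ideal_edges_def by blast
      from step[OF this False] obtain m where m: "m \<in> marks ?I" "x = src T m" by blast
      have "parent ?I (src ?I m) = out ?I (node_of ?I m)"
        using parent_src[OF injsI _ m(1)] rI rootI by simp
      then have par: "parent ?I x = parent T x" using m carr ps by auto
      have "(parent T ^^ k) (parent T x) = l" using Suc.prems by (simp add: funpow_swap1)
      from Suc.IH[OF this operadic_tree_parent_in[OF T Suc.prems(2)]]
      obtain j where "(parent ?I ^^ j) (parent ?I x) = l" using par by auto
      then have "(parent ?I ^^ Suc j) x = l" by (simp add: funpow_swap1)
      then show ?thesis by blast
    qed
  qed
  show "operadic_tree ?I"
    unfolding operadic_tree_def
  proof (intro conjI)
    show "\<forall>x\<in>edges ?I. \<exists>k. (parent ?I ^^ k) x = root ?I"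
      using reachI rootI carr(1) by (auto simp: ideal_edges_def)
    show "finite (edges ?I)" "finite (marks ?I)" "finite (nodes ?I)"
      using fin by (auto simp: carr ideal_edges_def)
    show "\<exists>r. edges ?I - src ?I ` marks ?I = {r}" using rI by blast
    show "inj_on (out ?I) (nodes ?I)" using injt carr by (auto simp: inj_on_def)
  qed (use sin p injsI carr in auto)
qed

lemma cuts_cover:
  assumes T: "operadic_tree T" and S: "S \<in> cuts T"
  shows "edges T \<subseteq> edges S \<union> (\<Union>l\<in>leaves S. edges (ideal_subtree T l))"
proof
  fix x assume x: "x \<in> edges T"
  have Sop: "operadic_tree S" and Semb: "tree_embedding S T (tree_id S)"
    and rS: "root T \<in> edges S" and sub: "edges S \<subseteq> edges T" "nodes S \<subseteq> nodes T"
    and eq: "src S = src T" "node_of S = node_of T" "out S = out T"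
    using S by (auto simp: cuts_def)
  have injt: "inj_on (out T) (nodes T)" using T by (simp add: operadic_tree_def)
  have pb: "m \<in> marks S" if "m \<in> marks T" "node_of T m \<in> nodes S" for m
  proof -
    have "(node_of T m, m) \<in> (\<lambda>m. (node_of S m, (\<lambda>x\<in>marks S. x) m)) ` marks S"
      using Semb that unfolding tree_embedding_def tree_id_def bij_betw_def by simp
    then show ?thesis by auto
  qed
  define j where "j = (LEAST j. (parent T ^^ j) x \<in> edges S)"
  have "\<exists>k. (parent T ^^ k) x \<in> edges S"
    using T x rS unfolding operadic_tree_def by metis
  then have j: "(parent T ^^ j) x \<in> edges S" and least: "\<And>i. i < j \<Longrightarrow> (parent T ^^ i) x \<notin> edges S"
    unfolding j_def by (auto intro: LeastI_ex dest: not_less_Least)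
  show "x \<in> edges S \<union> (\<Union>l\<in>leaves S. edges (ideal_subtree T l))"
  proof (cases j)
    case 0
    with j show ?thesis by simp
  next
    case (Suc i)
    define y where "y = (parent T ^^ i) x"
    have yT: "y \<in> edges T"
      unfolding y_def using x operadic_tree_parent_in[OF T] by (induction i) auto
    have y: "y \<notin> edges S" using least Suc y_def by blast
    have l: "(parent T ^^ j) x = parent T y" using Suc y_def by simp
    have "y \<noteq> root T" using y rS by auto
    then obtain m where m: "m \<in> marks T" "y = src T m" "parent T y = out T (node_of T m)"
      using operadic_tree_edge_cases[OF T yT] by metis
    have "parent T y \<in> leaves S"
    proof (rule ccontr)
      assume "parent T y \<notin> leaves S"
      with j l obtain n where n: "n \<in> nodes S" "parent T y = out T n"
        by (auto simp: leaves_def eq)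
      moreover have "node_of T m \<in> nodes T" using T m by (auto simp: operadic_tree_def)
      ultimately have "node_of T m = n"
        using m injt sub by (metis inj_onD subsetD)
      with pb m n have "m \<in> marks S" by auto
      with Sop m eq have "y \<in> edges S" by (auto simp: operadic_tree_def)
      with y show False by simp
    qed
    moreover have "x \<in> edges (ideal_subtree T (parent T y))"
      using x l by (auto simp: ideal_subtree_def ideal_edges_def)
    ultimately show ?thesis by blast
  qed
qed

definition forest_size :: "forest \<Rightarrow> nat" where
  "forest_size P = (\<Sum>X\<in>#P. tree_size X)"

lemma forest_size_plus: "forest_size (P + Q) = forest_size P + forest_size Q"
  by (simp add: forest_size_def)

lemma tree_size_cut:
  assumes S: "S \<in> cuts (rep X)"
  shows "tree_size X \<le> forest_size (pruned (rep X) S) + forest_size {#class_of S#}"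
proof -
  let ?T = "rep X"
  have T: "operadic_tree ?T" by (rule operadic_tree_rep)
  have Sop: "operadic_tree S" and sub: "edges S \<subseteq> edges ?T" using S by (auto simp: cuts_def)
  have fin: "finite (leaves S)" using Sop by (auto simp: leaves_def operadic_tree_def)
  have leT: "l \<in> edges ?T" if "l \<in> leaves S" for l using that sub by (auto simp: leaves_def)
  have "card (edges ?T) \<le> card (edges S \<union> (\<Union>l\<in>leaves S. edges (ideal_subtree ?T l)))"
    using cuts_cover[OF T S] fin Sop operadic_tree_ideal_subtree(1)[OF T leT]
    by (intro card_mono) (auto simp: operadic_tree_def)
  also have "\<dots> \<le> card (edges S) + card (\<Union>l\<in>leaves S. edges (ideal_subtree ?T l))"
    by (rule card_Un_le)
  also have "\<dots> \<le> card (edges S) + (\<Sum>l\<in>leaves S. card (edges (ideal_subtree ?T l)))"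
    using card_UN_le[OF fin] by simp
  also have "(\<Sum>l\<in>leaves S. card (edges (ideal_subtree ?T l))) =
      (\<Sum>l\<in>leaves S. tree_size (class_of (ideal_subtree ?T l)))"
    by (intro sum.cong refl) (simp add: tree_size_class_of operadic_tree_ideal_subtree(1)[OF T leT])
  also have "\<dots> = forest_size (pruned ?T S)"
    by (simp add: forest_size_def pruned_def image_mset.compositionality comp_def sum_unfold_sum_mset)
  finally show ?thesis
    by (simp add: forest_size_def tree_size_def[of X] tree_size_class_of[OF Sop])
qed

lemma comult_monomial: "comult (monomial m) = (\<Prod>X\<in>#m. comult_tree X)"
  by (simp add: comult_def)

lemma comult_generator: "comult (generator X) = comult_tree X"
  by (simp add: comult_monomial)

lemma comult_monomial_size:
  assumes "coeff (comult (monomial m) :: 'k::comm_ring_1 tree_algebra2) (P, Q) \<noteq> 0"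
  shows "forest_size m \<le> forest_size P + forest_size Q"
  using assms unfolding comult_monomial
proof (induction m arbitrary: P Q)
  case empty
  then show ?case by (simp add: forest_size_def)
next
  case (add X m)
  from add.prems have "(P, Q) \<in> Poly_Mapping.keys
      (comult_tree X * (\<Prod>X\<in>#m. comult_tree X) :: 'k tree_algebra2)"
    by (simp add: in_keys_iff)
  then obtain a b where a: "a \<in> Poly_Mapping.keys (comult_tree X :: 'k tree_algebra2)"
    and b: "b \<in> Poly_Mapping.keys ((\<Prod>X\<in>#m. comult_tree X) :: 'k tree_algebra2)"
    and ab: "(P, Q) = a + b"
    using subsetD[OF keys_mult] by blast
  have "a \<in> (\<Union>S\<in>cuts (rep X). Poly_Mapping.keys
      (monomial (pruned (rep X) S, {#class_of S#}) :: 'k tree_algebra2))"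
    using subsetD[OF keys_sum a[unfolded comult_tree_def]] .
  then obtain S where S: "S \<in> cuts (rep X)" "a = (pruned (rep X) S, {#class_of S#})"
    by (auto split: if_splits)
  have "forest_size m \<le> forest_size (fst b) + forest_size (snd b)"
    using b add.IH[of "fst b" "snd b"] by (simp add: in_keys_iff)
  with tree_size_cut[OF S(1)] ab S(2) show ?case
    by (cases b) (auto simp: forest_size_plus forest_size_def)
qed

lemma finite_multisets_bounded:
  assumes "finite A"
  shows "finite {m. set_mset m \<subseteq> A \<and> size m \<le> k}"
proof -
  have "{m. set_mset m \<subseteq> A \<and> size m \<le> k} = (\<Union>n\<in>{..k}. multisets_of_size A n)"
    by (auto simp: multisets_of_size_def)
  then show ?thesis using finite_multisets_of_size[OF assms] by simp
qed

lemma finite_forest_size_le: "finite {m. forest_size m \<le> k}"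
proof (rule finite_subset[OF _ finite_multisets_bounded[OF finite_tree_size_le]])
  have "size m \<le> forest_size m" for m
    unfolding forest_size_def
  proof (induction m)
    case (add X m)
    then show ?case using tree_size_pos[of X] by simp
  qed simp
  moreover have "tree_size X \<le> forest_size m" if "X \<in># m" for X m
    using that unfolding forest_size_def
    by (metis insert_DiffM le_add1 sum_mset.insert)
  ultimately show "{m. forest_size m \<le> k} \<subseteq> {m. set_mset m \<subseteq> {X. tree_size X \<le> k} \<and> size m \<le> k}"
    by (blast intro: order_trans)
qed

lemma formal_sum_has_formal_sum:
  "(\<And>x. finite {i \<in> I. F i x \<noteq> 0}) \<Longrightarrow> (F has_formal_sum formal_sum F I) I"
  by (simp add: has_formal_sum_def formal_sum_def)

lemma comult_hat_has_formal_sum: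
  "((\<lambda>m z. f m * coeff (comult (monomial m)) z) has_formal_sum comult_hat f) UNIV"
  unfolding comult_hat_def
proof (rule formal_sum_has_formal_sum)
  fix z :: "forest \<times> forest"
  have "{m \<in> UNIV. f m * coeff (comult (monomial m)) z \<noteq> 0} \<subseteq>
      {m. forest_size m \<le> forest_size (fst z) + forest_size (snd z)}"
    by (auto intro!: comult_monomial_size[where 'k = 'a])
  then show "finite {m \<in> UNIV. f m * coeff (comult (monomial m)) z \<noteq> 0}"
    using finite_forest_size_le finite_subset by blast
qed

lemma finite_series_mult: "finite {(a, b). a + b = (m :: 'x multiset)}"
proof -
  have "{(a, b). a + b = m} \<subseteq>
      {a. set_mset a \<subseteq> set_mset m \<and> size a \<le> size m} \<times> {a. set_mset a \<subseteq> set_mset m \<and> size a \<le> size m}"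
    by auto
  then show ?thesis
    by (rule finite_subset)
      (intro finite_cartesian_product finite_multisets_bounded[OF finite_set_mset])
qed

lemma green_term_has_formal_sum:
  "(green_term has_formal_sum green) UNIV"
  "(green_term has_formal_sum green_leaves n) {X. card (leaves (rep X)) = n}"
proof -
  have "finite {X \<in> I. green_term X m \<noteq> (0::'k::field_char_0)}" for I m
    by (rule finite_subset[of _ "set_mset m"]) (auto simp: green_term_def lookup_single when_def split: if_splits)
  then show "(green_term has_formal_sum (green :: 'a::field_char_0 tree_series)) UNIV"
    "(green_term has_formal_sum (green_leaves n :: 'b::field_char_0 tree_series)) {X. card (leaves (rep X)) = n}"
    unfolding green_def green_leaves_def by (auto intro!: formal_sum_has_formal_sum)
qed

lemma green_leaves_has_formal_sum:
  "(green_leaves has_formal_sum (green :: 'k::field_char_0 tree_series)) UNIV"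
proof -
  have coeffs: "(green_leaves n :: 'k tree_series) m =
      (if \<exists>X. m = {#X#} \<and> card (leaves (rep X)) = n then green m else 0)" for n m
  proof -
    have "{X. card (leaves (rep X)) = n \<and> green_term X m \<noteq> (0::'k)} =
        {X. green_term X m \<noteq> (0::'k)}" if "m = {#Y#}" "card (leaves (rep Y)) = n" for Y
      using that by (auto simp: green_term_def lookup_single when_def split: if_splits)
    moreover have "{X. card (leaves (rep X)) = n \<and> green_term X m \<noteq> (0::'k)} = {}"
      if "\<not> (\<exists>X. m = {#X#} \<and> card (leaves (rep X)) = n)"
      using that by (auto simp: green_term_def lookup_single when_def split: if_splits)
    ultimately show ?thesis by (auto simp: green_leaves_def green_def formal_sum_def)
  qed
  have "finite {n. (green_leaves n :: 'k tree_series) m \<noteq> 0} \<and>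
      green m = (\<Sum>n | (green_leaves n :: 'k tree_series) m \<noteq> 0. green_leaves n m :: 'k)" for m
  proof (cases "\<exists>X. m = {#X#}")
    case True
    then obtain X where m: "m = {#X#}" by blast
    have eq: "(green_leaves n :: 'k tree_series) m = (if n = card (leaves (rep X)) then green m else 0)" for n
      unfolding coeffs by (auto simp: m)
    have "{n. (green_leaves n :: 'k tree_series) m \<noteq> 0} =
        (if green m = (0::'k) then {} else {card (leaves (rep X))})"
      by (auto simp: eq)
    then show ?thesis by (simp add: eq)
  next
    case False
    then have "green_term X m = (0::'k)" for X
      by (auto simp: green_term_def lookup_single when_def)
    then have "green m = (0::'k)" by (simp add: green_def formal_sum_def)
    then have "(green_leaves n :: 'k tree_series) m = 0" for n by (simp add: coeffs)
    with \<open>green m = (0::'k)\<close> show ?thesis by simp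
  qed
  then show ?thesis by (simp add: has_formal_sum_def)
qed

lemma finite_Aut:
  assumes "operadic_tree T"
  shows "finite (Aut T)" "card (Aut T) > 0"
proof -
  have "Aut T \<subseteq> (edges T \<rightarrow>\<^sub>E edges T) \<times> (marks T \<rightarrow>\<^sub>E marks T) \<times> (nodes T \<rightarrow>\<^sub>E nodes T)"
    by (auto simp: Aut_def tree_iso_def tree_embedding_def)
  moreover have "finite ((edges T \<rightarrow>\<^sub>E edges T) \<times> (marks T \<rightarrow>\<^sub>E marks T) \<times> (nodes T \<rightarrow>\<^sub>E nodes T))"
    using assms by (intro finite_cartesian_product finite_PiE) (simp_all add: operadic_tree_def)
  ultimately show fin: "finite (Aut T)" by (rule finite_subset)
  have "tree_id T \<in> Aut T" using tree_iso_refl[OF assms] by (simp add: Aut_def)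
  with fin show "card (Aut T) > 0" using card_gt_0_iff by blast
qed

lemma comult_eq_sum:
  assumes "finite K" "Poly_Mapping.keys f \<subseteq> K"
  shows "comult f = (\<Sum>m\<in>K. Poly_Mapping.single 0 (coeff f m) * (\<Prod>X\<in>#m. comult_tree X))"
  unfolding comult_def using assms by (intro sum.mono_neutral_left) (auto simp: in_keys_iff)

lemma comult_add: "comult (f + g) = comult f + comult g"
proof -
  let ?K = "Poly_Mapping.keys f \<union> Poly_Mapping.keys g"
  have "finite ?K" by simp
  note eq = comult_eq_sum[OF this]
  show ?thesis
    unfolding eq[of f, simplified] eq[of g, simplified] eq[of "f + g", OF keys_add]
    by (simp add: lookup_add single_add distrib_right sum.distrib)
qed

lemma comult_single: "comult (Poly_Mapping.single m c) =
    Poly_Mapping.single 0 c * (\<Prod>X\<in>#m. comult_tree X)"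
  by (cases "c = 0") (simp_all add: comult_def)

lemma poly_mapping_single_add_induct [case_names single add]:
  fixes f :: "'x \<Rightarrow>\<^sub>0 'k::comm_monoid_add"
  assumes single: "\<And>m c. P (Poly_Mapping.single m c)" and add: "\<And>f g. P f \<Longrightarrow> P g \<Longrightarrow> P (f + g)"
  shows "P f"
proof (induction f rule: update_induct)
  case const
  show ?case using single[of undefined 0] by simp
next
  case (update f a b)
  have "Poly_Mapping.update a b f = f + Poly_Mapping.single a b"
    using update.hyps
    by (intro poly_mapping_eqI) (auto simp: lookup_add lookup_update lookup_single in_keys_iff when_def)
  with add[OF update.IH single] show ?case by simp
qed

lemma comult_mult: "comult (f * g :: 'a::comm_ring_1 tree_algebra) = comult f * comult g"
proof (induction f rule: poly_mapping_single_add_induct)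
  case (single m c)
  show ?case
  proof (induction g rule: poly_mapping_single_add_induct)
    case (single n d)
    let ?M = "(\<Prod>X\<in>#m. comult_tree X) :: 'a tree_algebra2"
      and ?N = "(\<Prod>X\<in>#n. comult_tree X) :: 'a tree_algebra2"
    have "comult (Poly_Mapping.single m c * Poly_Mapping.single n d) =
        Poly_Mapping.single 0 (c * d) * (?M * ?N)"
      by (simp add: mult_single comult_single)
    also have "Poly_Mapping.single 0 (c * d) = Poly_Mapping.single 0 c * (Poly_Mapping.single 0 d :: 'a tree_algebra2)"
      by (simp add: mult_single)
    also have "\<dots> * (?M * ?N) = (Poly_Mapping.single 0 c * ?M) * (Poly_Mapping.single 0 d * ?N)"
      by (simp only: mult_ac)
    finally show ?case by (simp only: comult_single)
  next
    case (add f1 f2)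
    then show ?case by (simp add: distrib_left comult_add)
  qed
next
  case (add f1 f2)
  then show ?case by (simp add: distrib_right comult_add)
qed

end

theory Submission
  imports Defs
begin

text \<open>
  An isomorphism of operadic trees is determined by its effect on the edges: it is a bijection of
  the edges that respects the parent map, the root and the leaves, and a cut is likewise determined
  by its edges and its leaves. Fix a forest \<open>F\<close> and a tree \<open>S\<close>, decorate the leaves of \<open>S\<close> with
  trees \<open>Z l\<close> whose product is \<open>F\<close>, and let \<open>G\<close> be the tree obtained by grafting the \<open>Z l\<close> onto \<open>S\<close>.
  An isomorphism \<open>G \<rightarrow> T\<close> amounts to a cut of \<open>T\<close>, an isomorphism from \<open>S\<close> to it, and isomorphisms
  from the \<open>Z l\<close> to the ideal subtrees over its leaves. Summing over all decorations, the number of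
  cuts of \<open>T\<close> of shape \<open>S\<close> with pruned forest \<open>F\<close>, times \<open>|Aut S|\<close> and the automorphism numbers of
  the factors of \<open>F\<close>, is \<open>|Aut T|\<close> times the number of decorations whose grafting is isomorphic to
  \<open>T\<close>. Division by \<open>|Aut T|\<close> and summation over \<open>T\<close> leaves the number of all decorations, which
  is also what the coefficient of \<open>F\<close> in the power of the Green function counts.
\<close>

section \<open>Trees in terms of their edges\<close>

lemma operadic_treeD:
  assumes "operadic_tree T"
  shows "finite (edges T)" "finite (marks T)" "finite (nodes T)"
    "\<And>m. m \<in> marks T \<Longrightarrow> src T m \<in> edges T" "\<And>m. m \<in> marks T \<Longrightarrow> node_of T m \<in> nodes T"
    "\<And>n. n \<in> nodes T \<Longrightarrow> out T n \<in> edges T"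
    "inj_on (out T) (nodes T)" "inj_on (src T) (marks T)"
    "root T \<in> edges T" "src T ` marks T = edges T - {root T}"
    "\<And>m. m \<in> marks T \<Longrightarrow> parent T (src T m) = out T (node_of T m)"
    "\<And>x. x \<in> edges T \<Longrightarrow> \<exists>k. (parent T ^^ k) x = root T"
proof -
  note r = operadic_tree_root[OF assms]
  show *: "\<And>m. m \<in> marks T \<Longrightarrow> src T m \<in> edges T" "inj_on (src T) (marks T)"
    using assms by (auto simp: operadic_tree_def)
  show "\<And>m. m \<in> marks T \<Longrightarrow> parent T (src T m) = out T (node_of T m)"
    using parent_src[OF *(2) r] .
  show "root T \<in> edges T" "src T ` marks T = edges T - {root T}"
    using r *(1) by blast+
qed (use assms in \<open>auto simp: operadic_tree_def\<close>)

section \<open>Leaves and walks along the parent map\<close>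

lemma leaves_subset: "leaves T \<subseteq> edges T"
  by (auto simp: leaves_def)

lemma finite_leaves: "operadic_tree T \<Longrightarrow> finite (leaves T)"
  using finite_subset[OF leaves_subset] operadic_treeD(1) .

lemma parent_not_leaf:
  assumes T: "operadic_tree T" and x: "x \<in> edges T" "x \<noteq> root T"
  shows "parent T x \<notin> leaves T"
  using operadic_tree_edge_cases[OF T x(1)] x(2) operadic_treeD(5)[OF T]
  by cases (auto simp: leaves_def)

lemma funpow_parent_in: "operadic_tree T \<Longrightarrow> x \<in> edges T \<Longrightarrow> (parent T ^^ k) x \<in> edges T"
  by (induction k) (auto intro: operadic_tree_parent_in)

text \<open>A walk that ends at a leaf has never moved: the parent of a non-root edge is the output
  of a node, and at the root the walk stands still.\<close>

lemma funpow_parent_leaf: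
  assumes T: "operadic_tree T" and x: "x \<in> edges T" and l: "(parent T ^^ k) x \<in> leaves T"
  shows "(parent T ^^ k) x = x"
  using l
proof (induction k)
  case (Suc k)
  let ?y = "(parent T ^^ k) x"
  have "?y = root T"
    using Suc.prems parent_not_leaf[OF T funpow_parent_in[OF T x, of k]] by auto
  then have "parent T ?y = ?y" by simp
  with Suc show ?case by simp
qed simp

section \<open>Isomorphisms as maps of edges\<close>

text \<open>Preservation of leaves has to be demanded separately, since the parent map does not
  distinguish a leaf from the output edge of a node without inputs. Extensionality makes these sets
  countable without overcounting.\<close>

definition edge_isos :: "('a, 'm, 'n) tree_diagram \<Rightarrow> ('b, 'k, 'l) tree_diagram \<Rightarrow> ('a \<Rightarrow> 'b) set" where
  "edge_isos S T = {\<alpha> \<in> extensional (edges S). bij_betw \<alpha> (edges S) (edges T) \<and>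
     \<alpha> (root S) = root T \<and> \<alpha> ` leaves S = leaves T \<and>
     (\<forall>x\<in>edges S. \<alpha> (parent S x) = parent T (\<alpha> x))}"

lemma tree_iso_imp_edge_iso:
  assumes S: "operadic_tree S" and T: "operadic_tree T" and iso: "tree_iso S T (\<alpha>, \<mu>, \<nu>)"
  shows "\<alpha> \<in> edge_isos S T"
proof -
  note S' = operadic_treeD[OF S] and T' = operadic_treeD[OF T]
  obtain \<alpha>' \<mu>' \<nu>' where g: "tree_embedding T S (\<alpha>', \<mu>', \<nu>')"
    "tree_comp S (\<alpha>', \<mu>', \<nu>') (\<alpha>, \<mu>, \<nu>) = tree_id S" and f: "tree_embedding S T (\<alpha>, \<mu>, \<nu>)"
    and g2: "tree_comp T (\<alpha>, \<mu>, \<nu>) (\<alpha>', \<mu>', \<nu>') = tree_id T"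
    using iso unfolding tree_iso_def by auto
  have comp: "compose (marks T) \<mu> \<mu>' = (\<lambda>x\<in>marks T. x)" "compose (nodes T) \<nu> \<nu>' = (\<lambda>x\<in>nodes T. x)"
    using g2 by (simp_all add: tree_comp_def tree_id_def)
  have bij: "bij_betw \<alpha> (edges S) (edges T)" using tree_iso_bij[OF iso] by simp
  have ext: "\<alpha> \<in> extensional (edges S)"
    and \<mu>: "\<And>m. m \<in> marks S \<Longrightarrow> \<mu> m \<in> marks T" and \<nu>: "\<And>m. m \<in> nodes S \<Longrightarrow> \<nu> m \<in> nodes T"
    and fs: "\<And>m. m \<in> marks S \<Longrightarrow> \<alpha> (src S m) = src T (\<mu> m)"
    and fp: "\<And>m. m \<in> marks S \<Longrightarrow> \<nu> (node_of S m) = node_of T (\<mu> m)"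
    and ft: "\<And>n. n \<in> nodes S \<Longrightarrow> \<alpha> (out S n) = out T (\<nu> n)"
    using f unfolding tree_embedding_def by (auto simp: PiE_iff)
  have \<mu>': "\<mu>' m \<in> marks S" "\<mu> (\<mu>' m) = m" if "m \<in> marks T" for m
    using that g(1) fun_cong[OF comp(1), of m] by (auto simp: tree_embedding_def PiE_iff compose_eq)
  have \<nu>': "\<nu>' m \<in> nodes S" "\<nu> (\<nu>' m) = m" if "m \<in> nodes T" for m
    using that g(1) fun_cong[OF comp(2), of m] by (auto simp: tree_embedding_def PiE_iff compose_eq)
  have sur: "\<mu> ` marks S = marks T" "\<nu> ` nodes S = nodes T"
    using \<mu> \<nu> by (auto intro: \<mu>'(1) \<nu>'(1) rev_image_eqI[where x = "\<mu>' _"] rev_image_eqI[where x = "\<nu>' _"] simp: \<mu>' \<nu>')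
  have im: "\<alpha> ` src S ` marks S = src T ` marks T" "\<alpha> ` out S ` nodes S = out T ` nodes T"
    unfolding sur[symmetric] image_image using fs ft by (simp_all cong: image_cong)
  have inj: "inj_on \<alpha> (edges S)" and \<alpha>: "\<alpha> ` edges S = edges T" using bij by (auto simp: bij_betw_def)
  \<comment> \<open>The root and the leaves are the complements of the images of \<open>src\<close>
    and \<open>out\<close>, and an injective map carries complements to complements.\<close>
  have "\<alpha> ` (edges S - src S ` marks S) = edges T - src T ` marks T"
    using inj_on_image_set_diff[OF inj] S'(4) \<alpha> im(1) by (metis Diff_subset image_subsetI subset_refl)
  then have root: "\<alpha> (root S) = root T"
    unfolding operadic_tree_root[OF S] operadic_tree_root[OF T] by auto
  have "\<alpha> ` leaves S = leaves T"
    unfolding leaves_def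
    using inj_on_image_set_diff[OF inj] S'(6) \<alpha> im(2) by (metis Diff_subset image_subsetI subset_refl)
  moreover have "\<alpha> (parent S x) = parent T (\<alpha> x)" if x: "x \<in> edges S" for x
    using operadic_tree_edge_cases[OF S x]
  proof cases
    case 1
    with root show ?thesis by simp
  next
    case (2 m)
    with S' T' fs fp ft \<mu> show ?thesis by metis
  qed
  ultimately show ?thesis using ext bij root by (simp add: edge_isos_def)
qed

text \<open>Since \<open>src\<close> and \<open>out\<close> are injective, marks are the same as
  non-root edges and nodes the same as non-leaf edges, so the edge component forces the other two
  components and also produces them.\<close>

lemma bij_betw_tree_iso_edge_isos:
  assumes S: "operadic_tree S" and T: "operadic_tree T"
  shows "bij_betw fst {f. tree_iso S T f} (edge_isos S T)"
proof -
  note S' = operadic_treeD[OF S] and T' = operadic_treeD[OF T]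
  have "inj_on fst {f. tree_iso S T f}"
  proof (rule inj_onI, clarsimp)
    fix \<alpha> \<mu> \<nu> \<mu>' \<nu>' assume "tree_iso S T (\<alpha>, \<mu>, \<nu>)" "tree_iso S T (\<alpha>, \<mu>', \<nu>')"
    then have e: "tree_embedding S T (\<alpha>, \<mu>, \<nu>)" "tree_embedding S T (\<alpha>, \<mu>', \<nu>')"
      by (auto simp: tree_iso_def)
    have "\<mu> = \<mu>'"
    proof (rule extensionalityI[of _ "marks S"])
      fix m assume m: "m \<in> marks S"
      then have "src T (\<mu> m) = src T (\<mu>' m)" "\<mu> m \<in> marks T" "\<mu>' m \<in> marks T"
        using e by (auto simp: tree_embedding_def PiE_iff)
      with T'(8) show "\<mu> m = \<mu>' m" by (auto dest: inj_onD)
    qed (use e in \<open>auto simp: tree_embedding_def PiE_iff\<close>)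
    moreover have "\<nu> = \<nu>'"
    proof (rule extensionalityI[of _ "nodes S"])
      fix m assume m: "m \<in> nodes S"
      then have "out T (\<nu> m) = out T (\<nu>' m)" "\<nu> m \<in> nodes T" "\<nu>' m \<in> nodes T"
        using e by (auto simp: tree_embedding_def PiE_iff)
      with T'(7) show "\<nu> m = \<nu>' m" by (auto dest: inj_onD)
    qed (use e in \<open>auto simp: tree_embedding_def PiE_iff\<close>)
    ultimately show "\<mu> = \<mu>' \<and> \<nu> = \<nu>'" ..
  qed
  moreover have "fst ` {f. tree_iso S T f} \<subseteq> edge_isos S T"
    using tree_iso_imp_edge_iso[OF S T] by auto
  moreover have "\<alpha> \<in> fst ` {f. tree_iso S T f}" if \<alpha>: "\<alpha> \<in> edge_isos S T" for \<alpha>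
  proof -
    have ext: "\<alpha> \<in> extensional (edges S)" and bij: "bij_betw \<alpha> (edges S) (edges T)"
      and root: "\<alpha> (root S) = root T" and lv: "\<alpha> ` leaves S = leaves T"
      and par: "\<And>x. x \<in> edges S \<Longrightarrow> \<alpha> (parent S x) = parent T (\<alpha> x)"
      using \<alpha> by (auto simp: edge_isos_def)
    have inj: "inj_on \<alpha> (edges S)" and im: "\<alpha> ` edges S = edges T" using bij by (auto simp: bij_betw_def)
    have src_im: "src T ` marks T = (\<alpha> \<circ> src S) ` marks S"
    proof -
      have "(\<alpha> \<circ> src S) ` marks S = \<alpha> ` (edges S - {root S})"
        by (simp only: image_comp[symmetric] S'(10))
      also have "\<dots> = edges T - {root T}"
        using inj_on_image_set_diff[OF inj, of "edges S" "{root S}"] S'(9) im root by auto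
      finally show ?thesis by (simp only: T'(10))
    qed
    have outS: "out S ` nodes S = edges S - leaves S" using S'(6) by (auto simp: leaves_def)
    have outT: "out T ` nodes T = edges T - leaves T" using T'(6) by (auto simp: leaves_def)
    have out_im: "out T ` nodes T = (\<alpha> \<circ> out S) ` nodes S"
    proof -
      have "(\<alpha> \<circ> out S) ` nodes S = \<alpha> ` (edges S - leaves S)"
        by (simp only: image_comp[symmetric] outS)
      also have "\<dots> = edges T - leaves T"
        using inj_on_image_set_diff[OF inj _ leaves_subset, of "edges S"] im lv by auto
      finally show ?thesis by (simp only: outT)
    qed
    have inj_src: "inj_on (\<alpha> \<circ> src S) (marks S)"
      by (rule comp_inj_on[OF S'(8)]) (use inj S'(10) in \<open>auto intro: inj_on_subset\<close>)
    have inj_out: "inj_on (\<alpha> \<circ> out S) (nodes S)"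
      by (rule comp_inj_on[OF S'(7)]) (use inj outS in \<open>auto intro: inj_on_subset\<close>)
    \<comment> \<open>The only candidates for the mark and node components: conjugate
      \<open>\<alpha>\<close> by \<open>src\<close> and by \<open>out\<close>.\<close>
    define \<mu> where "\<mu> = inv_into (marks T) (src T) \<circ> (\<alpha> \<circ> src S)"
    define \<nu> where "\<nu> = inv_into (nodes T) (out T) \<circ> (\<alpha> \<circ> out S)"
    have bm: "bij_betw \<mu> (marks S) (marks T)"
      unfolding \<mu>_def
      by (rule bij_betw_trans[OF inj_on_imp_bij_betw[OF inj_src]])
        (use T'(8) src_im in \<open>metis bij_betw_inv_into inj_on_imp_bij_betw\<close>)
    have bn: "bij_betw \<nu> (nodes S) (nodes T)"
      unfolding \<nu>_def
      by (rule bij_betw_trans[OF inj_on_imp_bij_betw[OF inj_out]])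
        (use T'(7) out_im in \<open>metis bij_betw_inv_into inj_on_imp_bij_betw\<close>)
    have sm: "\<alpha> (src S m) = src T (\<mu> m)" if "m \<in> marks S" for m
    proof -
      have "(\<alpha> \<circ> src S) m \<in> src T ` marks T" using that src_im by blast
      from f_inv_into_f[OF this] show ?thesis by (simp add: \<mu>_def)
    qed
    have tn: "\<alpha> (out S n) = out T (\<nu> n)" if "n \<in> nodes S" for n
    proof -
      have "(\<alpha> \<circ> out S) n \<in> out T ` nodes T" using that out_im by blast
      from f_inv_into_f[OF this] show ?thesis by (simp add: \<nu>_def)
    qed
    have pm: "\<nu> (node_of S m) = node_of T (\<mu> m)" if m: "m \<in> marks S" for m
    proof -
      have m': "\<mu> m \<in> marks T" using bm m by (auto simp: bij_betw_def)
      have n: "\<nu> (node_of S m) \<in> nodes T" using bn S'(5)[OF m] by (auto simp: bij_betw_def)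
      \<comment> \<open>After applying the injective \<open>out T\<close>, compatibility with
        \<open>node_of\<close> becomes compatibility of \<open>\<alpha>\<close> with the parent
        maps.\<close>
      have "out T (\<nu> (node_of S m)) = \<alpha> (parent S (src S m))"
        using tn[OF S'(5)[OF m]] S'(11)[OF m] by simp
      also have "\<dots> = out T (node_of T (\<mu> m))"
        using par[OF S'(4)[OF m]] sm[OF m] T'(11)[OF m'] by simp
      finally show ?thesis using T'(7) n T'(5)[OF m'] by (auto dest: inj_onD)
    qed
    have "tree_iso S T (\<lambda>x\<in>edges S. \<alpha> x, \<lambda>x\<in>marks S. \<mu> x, \<lambda>x\<in>nodes S. \<nu> x)"
      by (rule tree_iso_bijI[OF bij bm bn]) (use S' sm pm tn in auto)
    moreover have "(\<lambda>x\<in>edges S. \<alpha> x) = \<alpha>" by (rule extensional_restrict[OF ext])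
    ultimately show ?thesis by force
  qed
  ultimately show ?thesis unfolding bij_betw_def by blast
qed

lemma card_Aut: "operadic_tree T \<Longrightarrow> card (Aut T) = card (edge_isos T T)"
  unfolding Aut_def using bij_betw_same_card[OF bij_betw_tree_iso_edge_isos] by blast

lemma tree_rel_iff_edge_isos:
  "tree_rel S T \<longleftrightarrow> operadic_tree S \<and> operadic_tree T \<and> edge_isos S T \<noteq> {}"
  using bij_betw_tree_iso_edge_isos[of S T] unfolding tree_rel_def bij_betw_def by blast

lemma finite_edge_isos:
  assumes "operadic_tree S" "operadic_tree T"
  shows "finite (edge_isos S T)"
proof (rule finite_subset)
  show "edge_isos S T \<subseteq> edges S \<rightarrow>\<^sub>E edges T"
    by (auto simp: edge_isos_def PiE_def Pi_def dest: bij_betw_apply)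
qed (use assms in \<open>simp add: finite_PiE operadic_treeD(1)\<close>)

section \<open>Cuts in terms of their edges and leaves\<close>

text \<open>The pullback square forces every input of a node of the cut into the cut. Hence the
  nodes are those whose output is a non-leaf edge of the cut, the marks follow, and the cut is
  closed under passing from such an edge to its children.\<close>

lemma cutsD:
  assumes T: "operadic_tree T" and S: "S \<in> cuts T"
  shows "operadic_tree S" "edges S \<subseteq> edges T" "src S = src T" "node_of S = node_of T" "out S = out T"
    "root S = root T" "marks S = {m \<in> marks T. node_of T m \<in> nodes S}"
    "nodes S = {n \<in> nodes T. out T n \<in> edges S - leaves S}"
    "\<And>x. x \<in> edges S \<Longrightarrow> parent S x = parent T x"
    "leaves T \<inter> edges S \<subseteq> leaves S"
    "\<And>x. x \<in> edges T \<Longrightarrow> x \<noteq> root T \<Longrightarrow> parent T x \<in> edges S - leaves S \<Longrightarrow> x \<in> edges S"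
proof -
  show op: "operadic_tree S" and sub: "edges S \<subseteq> edges T"
    and eq: "src S = src T" "node_of S = node_of T" "out S = out T"
    using S by (auto simp: cuts_def)
  have sub': "marks S \<subseteq> marks T" "nodes S \<subseteq> nodes T" and rT: "root T \<in> edges S"
    using S by (auto simp: cuts_def)
  note T' = operadic_treeD[OF T] and S' = operadic_treeD[OF op]
  have "root T \<notin> src T ` marks T" using T'(10) by simp
  then have "root T \<in> edges S - src S ` marks S" using rT sub' eq by auto
  then show root: "root S = root T" using operadic_tree_root[OF op] by simp
  have pb: "m \<in> marks S" if "m \<in> marks T" "node_of T m \<in> nodes S" for m
  proof -
    have "tree_embedding S T (tree_id S)" using S by (simp add: cuts_def)
    then have "(node_of T m, m) \<in> (\<lambda>m. (node_of S m, (\<lambda>x\<in>marks S. x) m)) ` marks S"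
      using that unfolding tree_embedding_def tree_id_def bij_betw_def by simp
    then show ?thesis by auto
  qed
  show marks: "marks S = {m \<in> marks T. node_of T m \<in> nodes S}"
    using pb sub' S'(5) eq by auto
  show nodes: "nodes S = {n \<in> nodes T. out T n \<in> edges S - leaves S}"
  proof (intro subset_antisym subsetI)
    fix n assume "n \<in> nodes S"
    then show "n \<in> {n \<in> nodes T. out T n \<in> edges S - leaves S}"
      using sub' S'(6)[of n] eq by (auto simp: leaves_def)
  next
    fix n assume n: "n \<in> {n \<in> nodes T. out T n \<in> edges S - leaves S}"
    then obtain n' where "n' \<in> nodes S" "out T n = out T n'" using eq by (auto simp: leaves_def)
    with n show "n \<in> nodes S" using T'(7) sub' by (metis (no_types, lifting) inj_onD mem_Collect_eq subsetD)
  qed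
  show "parent S x = parent T x" if x: "x \<in> edges S" for x
    using operadic_tree_edge_cases[OF op x]
  proof cases
    case 1
    then show ?thesis using root parent_root by metis
  next
    case (2 m)
    then show ?thesis using eq T'(11)[of m] sub' by auto
  qed
  show "leaves T \<inter> edges S \<subseteq> leaves S" using sub' eq by (auto simp: leaves_def)
  show "x \<in> edges S" if x: "x \<in> edges T" "x \<noteq> root T" "parent T x \<in> edges S - leaves S" for x
    using operadic_tree_edge_cases[OF T x(1)]
  proof cases
    case (2 m)
    then have "node_of T m \<in> nodes S" using x(3) T'(5) nodes by auto
    then have "m \<in> marks S" using pb 2 by blast
    then show ?thesis using S'(4) 2 eq by auto
  qed (use x in simp)
qed

text \<open>The intended cut with edge set \<open>B\<close> and leaf set \<open>K\<close>. The edges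
  alone do not suffice: a node without inputs may be kept or cut off without changing them.\<close>

definition cut_of :: "('a, 'm, 'n) tree_diagram \<Rightarrow> 'a set \<Rightarrow> 'a set \<Rightarrow> ('a, 'm, 'n) tree_diagram" where
  "cut_of T B K = T\<lparr>edges := B, marks := {m \<in> marks T. out T (node_of T m) \<in> B - K},
     nodes := {n \<in> nodes T. out T n \<in> B - K}\<rparr>"

lemma cuts_eq_cut_of:
  assumes T: "operadic_tree T" and S: "S \<in> cuts T"
  shows "S = cut_of T (edges S) (leaves S)"
proof -
  obtain A M N where eq: "S = T\<lparr>edges := A, marks := M, nodes := N\<rparr>"
    using S by (auto simp: cuts_def)
  have "marks S = {m \<in> marks T. out T (node_of T m) \<in> edges S - leaves S}"
    using cutsD(7,8)[OF T S] operadic_treeD(5)[OF T] by blast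
  with cutsD(8)[OF T S] eq show ?thesis by (simp add: cut_of_def)
qed

text \<open>The hypothesis \<open>step\<close> combines closure under parents with the pullback
  condition: apart from the root, \<open>B\<close> consists of exactly the inputs of nodes with
  output in \<open>B - K\<close>. The condition on \<open>leaves T\<close> guarantees that each edge
  in \<open>B - K\<close> is the output of a node.\<close>

lemma cut_of_in_cuts:
  assumes T: "operadic_tree T" and B: "root T \<in> B" "B \<subseteq> edges T" and K: "K \<subseteq> B" "leaves T \<inter> B \<subseteq> K"
    and step: "\<And>x. x \<in> edges T \<Longrightarrow> x \<noteq> root T \<Longrightarrow> x \<in> B \<longleftrightarrow> parent T x \<in> B - K"
  shows "cut_of T B K \<in> cuts T" "leaves (cut_of T B K) = K"
proof -
  let ?S = "cut_of T B K"
  note T' = operadic_treeD[OF T]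
  have sel [simp]: "edges ?S = B" "src ?S = src T" "node_of ?S = node_of T" "out ?S = out T"
    and marks: "marks ?S = {m \<in> marks T. out T (node_of T m) \<in> B - K}"
    and nodes: "nodes ?S = {n \<in> nodes T. out T n \<in> B - K}"
    by (simp_all add: cut_of_def)
  have "out T ` nodes ?S = B - K"
    using K(2) B(2) by (auto simp: nodes leaves_def)
  then show "leaves ?S = K" using K(1) by (auto simp: leaves_def)
  \<comment> \<open>By \<open>step\<close>, the node of a mark has its output in
    \<open>B - K\<close> iff the edge of that mark lies in \<open>B\<close>.\<close>
  have "marks ?S = {m \<in> marks T. src T m \<in> B}"
    unfolding marks using step T'(4,10,11) by (metis (no_types, opaque_lifting) DiffD2 imageI singletonI)
  then have im: "src T ` marks ?S = B - {root T}"
    using T'(10) B by auto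
  then have r: "edges ?S - src ?S ` marks ?S = {root T}" using B by auto
  then have root: "root ?S = root T" by (rule root_eqI)
  have injs: "inj_on (src ?S) (marks ?S)" using T'(8) by (auto simp: marks inj_on_def)
  have par: "parent ?S x = parent T x" if x: "x \<in> B" for x
  proof (cases "x = root T")
    case False
    with x im obtain m where m: "m \<in> marks ?S" "x = src T m" by blast
    then show ?thesis
      using parent_src[OF injs _ m(1)] r root T'(11)[of m] by (simp add: marks)
  qed (use root in \<open>metis parent_root\<close>)
  have parB: "parent T x \<in> B" if "x \<in> B" for x
    using that step[of x] B by (cases "x = root T") auto
  have pows: "(parent ?S ^^ k) x = (parent T ^^ k) x \<and> (parent T ^^ k) x \<in> B" if "x \<in> B" for k x
    using that by (induction k) (auto simp: par parB)
  have op: "operadic_tree ?S"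
    unfolding operadic_tree_def
  proof (intro conjI)
    show "\<forall>x\<in>edges ?S. \<exists>k. (parent ?S ^^ k) x = root ?S"
      using pows root T'(12) B(2) by (metis sel(1) subsetD)
    show "inj_on (out ?S) (nodes ?S)" using T'(7) by (auto simp: nodes inj_on_def)
    show "src ?S \<in> marks ?S \<rightarrow> edges ?S" using im by auto
    show "node_of ?S \<in> marks ?S \<rightarrow> nodes ?S" using T'(5) by (auto simp: marks nodes)
    show "\<exists>r. edges ?S - src ?S ` marks ?S = {r}" using r by blast
  qed (use T' B finite_subset injs in \<open>auto simp: marks nodes\<close>)
  moreover have "tree_embedding ?S T (tree_id ?S)"
    unfolding tree_embedding_def tree_id_def bij_betw_def
    using operadic_treeD(4-6)[OF op] B by (auto simp: inj_on_def marks nodes)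
  ultimately show "?S \<in> cuts T"
    using B unfolding cuts_def by (auto simp: cut_of_def)
qed

section \<open>Embeddings onto cuts\<close>

text \<open>Isomorphisms onto cuts of \<open>T\<close>, with the cut left implicit as the image. The
  last clause is preservation of arities; the one before it keeps a node of \<open>S\<close> from
  landing where \<open>T\<close> has none.\<close>

definition root_embs :: "('a, 'm, 'n) tree_diagram \<Rightarrow> ('b, 'k, 'l) tree_diagram \<Rightarrow> ('a \<Rightarrow> 'b) set" where
  "root_embs S T = {f \<in> extensional (edges S). inj_on f (edges S) \<and> f ` edges S \<subseteq> edges T \<and>
     f (root S) = root T \<and> (\<forall>x\<in>edges S. f (parent S x) = parent T (f x)) \<and>
     (\<forall>x\<in>edges S. f x \<in> leaves T \<longrightarrow> x \<in> leaves S) \<and>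
     (\<forall>y\<in>edges T - {root T}. parent T y \<in> f ` (edges S - leaves S) \<longrightarrow> y \<in> f ` edges S)}"

text \<open>The images of the edges and of the leaves of \<open>S\<close> satisfy the criterion
  \<open>cut_of_in_cuts\<close>; conversely the closure properties in \<open>cutsD\<close> are the
  clauses of \<open>root_embs\<close>.\<close>

lemma root_embs_eq_UN_cuts:
  assumes S: "operadic_tree S" and T: "operadic_tree T"
  shows "root_embs S T = (\<Union>C\<in>cuts T. edge_isos S C)"
proof (intro subset_antisym subsetI)
  fix f assume f: "f \<in> root_embs S T"
  note S' = operadic_treeD[OF S]
  have inj: "inj_on f (edges S)" and im: "f ` edges S \<subseteq> edges T" and root: "f (root S) = root T"
    and par: "\<And>x. x \<in> edges S \<Longrightarrow> f (parent S x) = parent T (f x)"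
    and lv: "\<And>x. x \<in> edges S \<Longrightarrow> f x \<in> leaves T \<Longrightarrow> x \<in> leaves S"
    and cl: "\<And>y. y \<in> edges T \<Longrightarrow> y \<noteq> root T \<Longrightarrow> parent T y \<in> f ` (edges S - leaves S) \<Longrightarrow> y \<in> f ` edges S"
    using f by (auto simp: root_embs_def)
  let ?B = "f ` edges S" and ?K = "f ` leaves S"
  have BK: "?B - ?K = f ` (edges S - leaves S)"
    using inj_on_image_set_diff[OF inj _ leaves_subset] by auto
  have rB: "root T \<in> ?B" using root S'(9) by (metis imageI)
  have step: "y \<in> ?B \<longleftrightarrow> parent T y \<in> ?B - ?K" if y: "y \<in> edges T" "y \<noteq> root T" for y
  proof
    assume "y \<in> ?B"
    then obtain x where x: "x \<in> edges S" "y = f x" by blast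
    then have "x \<noteq> root S" using y root by auto
    with x parent_not_leaf[OF S x(1)] par[OF x(1)] operadic_tree_parent_in[OF S x(1)]
    show "parent T y \<in> ?B - ?K" unfolding BK by (metis Diff_iff imageI)
  qed (use cl y BK in auto)
  have K: "?K \<subseteq> ?B" "leaves T \<inter> ?B \<subseteq> ?K" using leaves_subset[of S] lv by auto
  let ?C = "cut_of T ?B ?K"
  note C = cut_of_in_cuts[OF T rB im K step]
  have e: "edges ?C = ?B" by (simp add: cut_of_def)
  have "f \<in> edge_isos S ?C"
    unfolding edge_isos_def
  proof (intro CollectI conjI)
    show "\<forall>x\<in>edges S. f (parent S x) = parent ?C (f x)"
      using cutsD(9)[OF T C(1)] par by (simp add: e)
  qed (use f e inj root C(2) cutsD(6)[OF T C(1)] in \<open>auto simp: root_embs_def bij_betw_def\<close>)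
  with C(1) show "f \<in> (\<Union>C\<in>cuts T. edge_isos S C)" by blast
next
  fix f assume "f \<in> (\<Union>C\<in>cuts T. edge_isos S C)"
  then obtain C where C: "C \<in> cuts T" and f: "f \<in> edge_isos S C" by blast
  note C' = cutsD[OF T C]
  have inj: "inj_on f (edges S)" and im: "f ` edges S = edges C" and lv: "f ` leaves S = leaves C"
    using f by (auto simp: edge_isos_def bij_betw_def)
  have "f ` (edges S - leaves S) = edges C - leaves C"
    using inj_on_image_set_diff[OF inj _ leaves_subset, of "edges S"] im lv by auto
  moreover have "x \<in> leaves S" if "x \<in> edges S" "f x \<in> leaves T" for x
  proof -
    have "f x \<in> f ` leaves S" using that im lv C'(10) by auto
    then show ?thesis using inj_on_image_mem_iff[OF inj that(1) leaves_subset] by simp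
  qed
  moreover have "f (parent S x) = parent T (f x)" if "x \<in> edges S" for x
    using that f im C'(9)[of "f x"] by (auto simp: edge_isos_def)
  ultimately show "f \<in> root_embs S T"
    using f inj im C'(2,6,11) by (auto simp: root_embs_def edge_isos_def)
qed

text \<open>An isomorphism onto a cut determines the edges and leaves of that cut, hence the cut
  itself. This makes the union over cuts a disjoint one, fit for summation.\<close>

lemma edge_isos_cuts_disjoint:
  assumes T: "operadic_tree T" and "C \<in> cuts T" "C' \<in> cuts T" "C \<noteq> C'"
  shows "edge_isos S C \<inter> edge_isos S C' = {}"
proof (rule ccontr)
  assume "edge_isos S C \<inter> edge_isos S C' \<noteq> {}"
  then have "edges C = edges C'" "leaves C = leaves C'" by (auto simp: edge_isos_def bij_betw_def)
  with assms show False using cuts_eq_cut_of[OF T] by metis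
qed

section \<open>Composition, inverses and numbers of isomorphisms\<close>

lemma edge_isos_comp:
  assumes f: "f \<in> edge_isos R S" and g: "g \<in> edge_isos S T" and R: "operadic_tree R"
  shows "compose (edges R) g f \<in> edge_isos R T"
proof -
  have lv: "(\<lambda>x. compose (edges R) g f x) ` leaves R = g ` f ` leaves R"
    unfolding image_image by (intro image_cong) (simp_all add: compose_eq subsetD[OF leaves_subset])
  show ?thesis
    using assms lv bij_betw_compose[of f "edges R" "edges S" g "edges T"]
    by (auto simp: edge_isos_def compose_eq operadic_treeD(9) operadic_tree_parent_in bij_betw_apply)
qed

lemma edge_isos_inverse:
  assumes f: "f \<in> edge_isos S T" and S: "operadic_tree S" and T: "operadic_tree T"
  shows "(\<lambda>y\<in>edges T. inv_into (edges S) f y) \<in> edge_isos T S"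
proof -
  have bij: "bij_betw f (edges S) (edges T)" and inj: "inj_on f (edges S)"
    and lv: "f ` leaves S = leaves T" and root: "f (root S) = root T"
    and par: "\<And>x. x \<in> edges S \<Longrightarrow> f (parent S x) = parent T (f x)"
    using f by (auto simp: edge_isos_def bij_betw_def)
  let ?g = "inv_into (edges S) f"
  have inv: "?g (f x) = x" if "x \<in> edges S" for x using inj that by simp
  have "?g ` f ` leaves S = leaves S"
    using inv_into_image_cancel[OF inj leaves_subset] .
  then have "(\<lambda>y\<in>edges T. ?g y) ` leaves T = leaves S"
    using leaves_subset[of T] lv by (auto simp: image_def cong: bex_cong) blast+
  moreover have "?g (parent T y) = parent S (?g y)" if y: "y \<in> edges T" for y
  proof -
    obtain x where x: "x \<in> edges S" "y = f x" using y bij by (auto simp: bij_betw_def)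
    then show ?thesis using par[OF x(1)] inv operadic_tree_parent_in[OF S] by metis
  qed
  ultimately show ?thesis
    using bij_betw_inv_into[OF bij] root inv[OF operadic_treeD(9)[OF S]]
    by (auto simp: edge_isos_def operadic_treeD(9)[OF T] operadic_tree_parent_in[OF T])
qed

text \<open>Precomposition with \<open>h\<close> is injective because \<open>h\<close> is onto the
  edges of \<open>R\<close>.\<close>

lemma card_edge_isos_le_source:
  assumes R: "operadic_tree R" "operadic_tree R'" and T: "operadic_tree T"
    and h: "h \<in> edge_isos R' R"
  shows "card (edge_isos R T) \<le> card (edge_isos R' T)"
proof (rule card_inj_on_le[where f = "\<lambda>g. compose (edges R') g h"])
  show "inj_on (\<lambda>g. compose (edges R') g h) (edge_isos R T)"
  proof (rule inj_onI)
    fix g g' assume g: "g \<in> edge_isos R T" "g' \<in> edge_isos R T"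
      and eq: "compose (edges R') g h = compose (edges R') g' h"
    show "g = g'"
    proof (rule extensionalityI[of _ "edges R"])
      fix x assume "x \<in> edges R"
      then have "x \<in> h ` edges R'" using h by (simp add: edge_isos_def bij_betw_def)
      then obtain y where "y \<in> edges R'" "x = h y" by blast
      then show "g x = g' x" using fun_cong[OF eq, of y] by (simp add: compose_eq)
    qed (use g in \<open>auto simp: edge_isos_def\<close>)
  qed
qed (use edge_isos_comp[OF h _ R(2)] finite_edge_isos[OF R(2) T] in auto)

lemma card_edge_isos_le_target:
  assumes R: "operadic_tree R" and T: "operadic_tree T" "operadic_tree T'"
    and h: "h \<in> edge_isos T T'"
  shows "card (edge_isos R T) \<le> card (edge_isos R T')"
proof (rule card_inj_on_le[where f = "\<lambda>g. compose (edges R) h g"])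
  show "inj_on (\<lambda>g. compose (edges R) h g) (edge_isos R T)"
  proof (rule inj_onI)
    fix g g' assume g: "g \<in> edge_isos R T" "g' \<in> edge_isos R T"
      and eq: "compose (edges R) h g = compose (edges R) h g'"
    show "g = g'"
    proof (rule extensionalityI[of _ "edges R"])
      fix x assume x: "x \<in> edges R"
      then have "g x \<in> edges T" "g' x \<in> edges T" using g by (auto simp: edge_isos_def bij_betw_def)
      moreover have "h (g x) = h (g' x)" using fun_cong[OF eq, of x] x by (simp add: compose_eq)
      ultimately show "g x = g' x" using h by (auto simp: edge_isos_def bij_betw_def dest: inj_onD)
    qed (use g in \<open>auto simp: edge_isos_def\<close>)
  qed
qed (use edge_isos_comp[OF _ h R] finite_edge_isos[OF R T(2)] in auto)

text \<open>A non-empty set of isomorphisms is a torsor under either automorphism group. Composing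
  with a chosen isomorphism and with its inverse gives the two inequalities.\<close>

lemma card_edge_isos:
  assumes S: "operadic_tree S" and T: "operadic_tree T" and ne: "edge_isos S T \<noteq> {}"
  shows "card (edge_isos S T) = card (edge_isos T T)" "card (edge_isos S T) = card (edge_isos S S)"
proof -
  obtain h where h: "h \<in> edge_isos S T" using ne by blast
  note h' = edge_isos_inverse[OF h S T]
  show "card (edge_isos S T) = card (edge_isos T T)"
    by (rule antisym[OF card_edge_isos_le_source[OF S T T h'] card_edge_isos_le_source[OF T S T h]])
  show "card (edge_isos S T) = card (edge_isos S S)"
    by (rule antisym[OF card_edge_isos_le_target[OF S T S h'] card_edge_isos_le_target[OF S S T h]])
qed

section \<open>Ideal subtrees, and trees built from a parent map\<close>

lemma edges_ideal_subtree [simp]: "edges (ideal_subtree T l) = ideal_edges T l"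
  by (simp add: ideal_subtree_def)

lemma leaves_ideal_subtree: "leaves (ideal_subtree T l) = leaves T \<inter> ideal_edges T l"
  by (auto simp: leaves_def ideal_subtree_def ideal_edges_def)

text \<open>The edge \<open>l\<close> is excluded because it is the root of the ideal subtree, whose
  parent map fixes it, whereas the walk in \<open>T\<close> may go on.\<close>

lemma parent_ideal_subtree:
  assumes T: "operadic_tree T" and l: "l \<in> edges T" and x: "x \<in> ideal_edges T l" "x \<noteq> l"
  shows "parent (ideal_subtree T l) x = parent T x"
proof -
  have "x \<in> edges (ideal_subtree T l)" using x by simp
  from operadic_tree_edge_cases[OF operadic_tree_ideal_subtree(1)[OF T l] this] show ?thesis
  proof cases
    case 1
    with x operadic_tree_ideal_subtree(2)[OF T l] show ?thesis by simp
  next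
    case (2 m)
    then show ?thesis using operadic_treeD(11)[OF T, of m] by (simp add: ideal_subtree_def)
  qed
qed

text \<open>The converse of the description by edges: a finite set with a map whose iterates all
  reach \<open>r\<close> and with a set \<open>L\<close> of leaves is realised by taking non-root
  edges as marks and non-leaf edges as nodes. That no parent lies in \<open>L\<close> makes
  \<open>\<sigma>\<close> land in the nodes.\<close>

lemma operadic_tree_of_parent:
  assumes fin: "finite A" and r: "r \<in> A" "\<sigma> r = r" and \<sigma>: "\<And>x. x \<in> A \<Longrightarrow> \<sigma> x \<in> A"
    and L: "L \<subseteq> A" "\<And>x. x \<in> A \<Longrightarrow> x \<noteq> r \<Longrightarrow> \<sigma> x \<notin> L"
    and reach: "\<And>x. x \<in> A \<Longrightarrow> \<exists>k. (\<sigma> ^^ k) x = r"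
  defines "T \<equiv> \<lparr>edges = A, marks = A - {r}, nodes = A - L, src = id, node_of = \<sigma>, out = id\<rparr>"
  shows "operadic_tree T" "root T = r" "leaves T = L" "\<And>x. x \<in> A \<Longrightarrow> parent T x = \<sigma> x"
proof -
  have sel: "edges T = A" "marks T = A - {r}" "nodes T = A - L" "src T = id" "node_of T = \<sigma>" "out T = id"
    by (simp_all add: T_def)
  have *: "edges T - src T ` marks T = {r}" using r by (auto simp: sel)
  then show root: "root T = r" by (rule root_eqI)
  show "leaves T = L" using L by (auto simp: leaves_def sel)
  have par: "parent T x = \<sigma> x" if "x \<in> A" for x
    using that root r parent_src[of T x] * by (cases "x = r") (auto simp: sel parent_def)
  then show "\<And>x. x \<in> A \<Longrightarrow> parent T x = \<sigma> x" .
  have pows: "(parent T ^^ k) x = (\<sigma> ^^ k) x \<and> (\<sigma> ^^ k) x \<in> A" if "x \<in> A" for k x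
    using that by (induction k) (auto simp: par \<sigma>)
  have "\<forall>x\<in>edges T. \<exists>k. (parent T ^^ k) x = root T"
    using pows reach root by (metis sel(1))
  with * show "operadic_tree T"
    unfolding operadic_tree_def using fin \<sigma> L by (auto simp: sel)
qed

section \<open>Grafting\<close>

text \<open>The root of \<open>Z l\<close> is glued to the leaf \<open>l\<close>.\<close>

definition graft_edge :: "('a \<Rightarrow> ('b, 'm, 'n) tree_diagram) \<Rightarrow> 'a \<Rightarrow> 'b \<Rightarrow> 'a + 'a \<times> 'b" where
  "graft_edge Z l y = (if y = root (Z l) then Inl l else Inr (l, y))"

text \<open>The outer \<open>graft_edge\<close> hands the walk over to \<open>Inl l\<close> as soon
  as it arrives at the root of \<open>Z l\<close>.\<close>

definition graft_parent ::
  "('a, 'k, 'l) tree_diagram \<Rightarrow> ('a \<Rightarrow> ('b, 'm, 'n) tree_diagram) \<Rightarrow> 'a + 'a \<times> 'b \<Rightarrow> 'a + 'a \<times> 'b" where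
  "graft_parent S Z z =
     (case z of Inl x \<Rightarrow> Inl (parent S x) | Inr (l, y) \<Rightarrow> graft_edge Z l (parent (Z l) y))"

definition graft_edges ::
  "('a, 'k, 'l) tree_diagram \<Rightarrow> ('a \<Rightarrow> ('b, 'm, 'n) tree_diagram) \<Rightarrow> ('a + 'a \<times> 'b) set" where
  "graft_edges S Z = Inl ` edges S \<union> (\<Union>l\<in>leaves S. graft_edge Z l ` edges (Z l))"

text \<open>The edge \<open>Inl l\<close> is among these exactly when the root of \<open>Z l\<close>
  is a leaf, as happens for the trivial tree.\<close>

definition graft_leaves ::
  "('a, 'k, 'l) tree_diagram \<Rightarrow> ('a \<Rightarrow> ('b, 'm, 'n) tree_diagram) \<Rightarrow> ('a + 'a \<times> 'b) set" where
  "graft_leaves S Z = (\<Union>l\<in>leaves S. graft_edge Z l ` leaves (Z l))"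

text \<open>Written in the form of \<open>operadic_tree_of_parent\<close>, which then yields the
  tree axioms at once.\<close>

definition graft ::
  "('a, 'k, 'l) tree_diagram \<Rightarrow> ('a \<Rightarrow> ('b, 'm, 'n) tree_diagram) \<Rightarrow>
   ('a + 'a \<times> 'b, 'a + 'a \<times> 'b, 'a + 'a \<times> 'b) tree_diagram" where
  "graft S Z = \<lparr>edges = graft_edges S Z, marks = graft_edges S Z - {Inl (root S)},
     nodes = graft_edges S Z - graft_leaves S Z, src = id, node_of = graft_parent S Z, out = id\<rparr>"

lemma graft_edge_eq_iff [simp]: "graft_edge Z l y = graft_edge Z l' y' \<longleftrightarrow> l = l' \<and> y = y'"
  by (auto simp: graft_edge_def)

lemma graft_edge_root [simp]: "graft_edge Z l (root (Z l)) = Inl l"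
  by (simp add: graft_edge_def)

lemma graft_edge_eq_Inl: "graft_edge Z l y = Inl x \<longleftrightarrow> x = l \<and> y = root (Z l)"
  by (auto simp: graft_edge_def)

lemma graft_parent_Inl [simp]: "graft_parent S Z (Inl x) = Inl (parent S x)"
  by (simp add: graft_parent_def)

lemma graft_parent_graft_edge:
  "y \<noteq> root (Z l) \<Longrightarrow> graft_parent S Z (graft_edge Z l y) = graft_edge Z l (parent (Z l) y)"
  by (simp add: graft_parent_def graft_edge_def)

lemma graft_parent_funpow_Inl: "(graft_parent S Z ^^ k) (Inl x) = Inl ((parent S ^^ k) x)"
  by (induction k) auto

lemma graft_parent_reach:
  assumes "operadic_tree (Z l)" "y \<in> edges (Z l)"
  shows "\<exists>k. (graft_parent S Z ^^ k) (graft_edge Z l y) = Inl l"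
proof -
  have "\<exists>j. (graft_parent S Z ^^ j) (graft_edge Z l y) = Inl l"
    if "(parent (Z l) ^^ k) y = root (Z l)" for k y
    using that
  proof (induction k arbitrary: y)
    case 0
    then show ?case by (auto intro: exI[of _ 0])
  next
    case (Suc k)
    show ?case
    proof (cases "y = root (Z l)")
      case True
      then show ?thesis by (auto intro: exI[of _ 0])
    next
      case False
      from Suc.prems have "(parent (Z l) ^^ k) (parent (Z l) y) = root (Z l)" by (simp add: funpow_swap1)
      from Suc.IH[OF this] obtain j where
        "(graft_parent S Z ^^ j) (graft_parent S Z (graft_edge Z l y)) = Inl l"
        using graft_parent_graft_edge[of y Z l S] False by auto
      then show ?thesis by (intro exI[of _ "Suc j"]) (simp add: funpow_swap1)
    qed
  qed
  with operadic_treeD(12)[OF assms] show ?thesis by blast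
qed

text \<open>A walk that starts in \<open>Z l'\<close> enters \<open>S\<close> at \<open>l'\<close>,
  and from there on it meets no leaf of \<open>S\<close> other than \<open>l'\<close>. So the edges
  over different leaves are kept apart.\<close>

lemma graft_parent_funpow_leaf:
  assumes S: "operadic_tree S" and l: "l \<in> leaves S" "l' \<in> leaves S"
    and eq: "(graft_parent S Z ^^ k) (graft_edge Z l' w) = Inl l"
  shows "l' = l"
  using eq
proof (induction k arbitrary: w)
  case 0
  then show ?case by (simp add: graft_edge_eq_Inl)
next
  case (Suc k)
  show ?case
  proof (cases "w = root (Z l')")
    case True
    with Suc.prems have "(parent S ^^ Suc k) l' = l"
      using graft_parent_funpow_Inl[of "Suc k" S Z l'] by simp
    then show ?thesis using funpow_parent_leaf[OF S, of l' "Suc k"] l leaves_subset by fastforce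
  next
    case False
    from Suc.prems have "(graft_parent S Z ^^ k) (graft_parent S Z (graft_edge Z l' w)) = Inl l"
      by (simp add: funpow_swap1)
    with Suc.IH show ?thesis using False by (simp add: graft_parent_graft_edge)
  qed
qed

lemma edges_graft [simp]: "edges (graft S Z) = graft_edges S Z"
  by (simp add: graft_def)

lemma operadic_tree_graft:
  assumes S: "operadic_tree S" and Z: "\<And>l. l \<in> leaves S \<Longrightarrow> operadic_tree (Z l)"
  shows "operadic_tree (graft S Z)" "root (graft S Z) = Inl (root S)"
    "leaves (graft S Z) = graft_leaves S Z"
    "\<And>x. x \<in> graft_edges S Z \<Longrightarrow> parent (graft S Z) x = graft_parent S Z x"
proof -
  note S' = operadic_treeD[OF S]
  have "\<exists>k. (graft_parent S Z ^^ k) (Inl x) = Inl (root S)" if "x \<in> edges S" for x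
    using S'(12)[OF that] by (auto simp: graft_parent_funpow_Inl)
  moreover have "\<exists>k. (graft_parent S Z ^^ k) (graft_edge Z l y) = Inl (root S)"
    if ly: "l \<in> leaves S" "y \<in> edges (Z l)" for l y
  proof -
    obtain j where j: "(graft_parent S Z ^^ j) (graft_edge Z l y) = Inl l"
      using graft_parent_reach[of Z l y S] Z ly by blast
    obtain i where i: "(parent S ^^ i) l = root S" using S'(12) leaves_subset ly(1) by fast
    have "(graft_parent S Z ^^ (i + j)) (graft_edge Z l y) = Inl (root S)"
      by (simp add: funpow_add j i graft_parent_funpow_Inl)
    then show ?thesis ..
  qed
  ultimately have reach: "\<exists>k. (graft_parent S Z ^^ k) x = Inl (root S)" if "x \<in> graft_edges S Z" for x
    using that by (auto simp: graft_edges_def)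
  have par: "graft_parent S Z (graft_edge Z l y) \<in> graft_edges S Z"
    if "l \<in> leaves S" "y \<in> edges (Z l)" for l y
  proof (cases "y = root (Z l)")
    case True
    with that leaves_subset[of S] show ?thesis
      by (auto simp: graft_edges_def intro!: operadic_tree_parent_in[OF S])
  next
    case False
    have "parent (Z l) y \<in> edges (Z l)" using that operadic_tree_parent_in[OF Z] by blast
    with that(1) show ?thesis
      unfolding graft_parent_graft_edge[where Z = Z, OF False] graft_edges_def by blast
  qed
  have fin: "finite (graft_edges S Z)"
    using S'(1) finite_leaves[OF S] operadic_treeD(1)[OF Z] by (auto simp: graft_edges_def)
  \<comment> \<open>A grafted leaf of the form \<open>Inl x\<close> has \<open>x\<close> a leaf of
    \<open>S\<close>, and a leaf is not the parent of a non-root edge.\<close>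
  have inl: "graft_parent S Z (Inl x) \<notin> graft_leaves S Z" if "x \<in> edges S" "x \<noteq> root S" for x
    using parent_not_leaf[OF S that] by (auto simp: graft_leaves_def graft_edge_eq_Inl dest: sym)
  \<comment> \<open>The root of \<open>Z l\<close> is the edge \<open>Inl l\<close>, whose parent is
    computed in \<open>S\<close>; every other edge has its parent inside \<open>Z l\<close>.\<close>
  have *: "graft_parent S Z (graft_edge Z l y) \<notin> graft_leaves S Z"
    if "l \<in> leaves S" "y \<in> edges (Z l)" "graft_edge Z l y \<noteq> Inl (root S)" for l y
  proof (cases "y = root (Z l)")
    case True
    with that leaves_subset[of S] inl[of l] show ?thesis by auto
  next
    case False
    with that parent_not_leaf[OF Z[OF that(1)] that(2)] show ?thesis
      by (auto simp: graft_leaves_def graft_parent_graft_edge)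
  qed
  have nl: "graft_parent S Z x \<notin> graft_leaves S Z"
    if x: "x \<in> graft_edges S Z" "x \<noteq> Inl (root S)" for x
  proof -
    from x(1) consider y where "x = Inl y" "y \<in> edges S"
      | l y where "x = graft_edge Z l y" "l \<in> leaves S" "y \<in> edges (Z l)"
      unfolding graft_edges_def by blast
    then show ?thesis using inl * x(2) by cases blast+
  qed
  have L: "graft_leaves S Z \<subseteq> graft_edges S Z"
    using leaves_subset by (fastforce simp: graft_leaves_def graft_edges_def)
  have R: "Inl (root S) \<in> graft_edges S Z" using S'(9) by (simp add: graft_edges_def)
  have P: "graft_parent S Z x \<in> graft_edges S Z" if "x \<in> graft_edges S Z" for x
    using that par operadic_tree_parent_in[OF S] by (auto simp: graft_edges_def)
  have root_fixed: "graft_parent S Z (Inl (root S)) = Inl (root S)" by simp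
  note * = operadic_tree_of_parent[where \<sigma> = "graft_parent S Z", OF fin R root_fixed P L nl reach, folded graft_def]
  show "operadic_tree (graft S Z)" "root (graft S Z) = Inl (root S)"
    "leaves (graft S Z) = graft_leaves S Z" using * by blast+
  show "\<And>x. x \<in> graft_edges S Z \<Longrightarrow> parent (graft S Z) x = graft_parent S Z x"
    using *(4) .
qed

section \<open>Ideal subtrees over the leaves of an embedded tree\<close>

text \<open>Induction on the distance to the root. If the parent of an edge is the image of a
  non-leaf, the edge itself is in the image; if it is the image of a leaf or already lies in an
  ideal, the edge lies in that ideal.\<close>

lemma root_emb_cover:
  assumes S: "operadic_tree S" and T: "operadic_tree T" and f: "f \<in> root_embs S T" and y: "y \<in> edges T"
  shows "y \<in> f ` edges S \<or> (\<exists>l\<in>leaves S. y \<in> ideal_edges T (f l))"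
proof -
  have root: "f (root S) = root T"
    and cl: "\<And>y. y \<in> edges T \<Longrightarrow> y \<noteq> root T \<Longrightarrow> parent T y \<in> f ` (edges S - leaves S) \<Longrightarrow> y \<in> f ` edges S"
    using f by (auto simp: root_embs_def)
  have rin: "root T \<in> f ` edges S" using root operadic_treeD(9)[OF S] by (metis imageI)
  have "y \<in> f ` edges S \<or> (\<exists>l\<in>leaves S. y \<in> ideal_edges T (f l))"
    if "(parent T ^^ k) y = root T" "y \<in> edges T" for k
    using that
  proof (induction k arbitrary: y)
    case 0
    with rin show ?case by simp
  next
    case (Suc k)
    have up: "y \<in> ideal_edges T l" if "parent T y \<in> ideal_edges T l" for l
    proof -
      from that obtain j where "(parent T ^^ j) (parent T y) = l" by (auto simp: ideal_edges_def)
      then have "(parent T ^^ Suc j) y = l" by (simp add: funpow_swap1)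
      with Suc.prems(2) show ?thesis unfolding ideal_edges_def by blast
    qed
    have "(parent T ^^ k) (parent T y) = root T" using Suc.prems(1) by (simp add: funpow_swap1)
    from Suc.IH[OF this operadic_tree_parent_in[OF T Suc.prems(2)]] show ?case
    proof
      assume "parent T y \<in> f ` edges S"
      then obtain x where x: "x \<in> edges S" "parent T y = f x" by blast
      show ?thesis
      proof (cases "x \<in> leaves S")
        case True
        have "parent T y \<in> ideal_edges T (f x)"
          using x operadic_tree_parent_in[OF T Suc.prems(2)] by (auto simp: ideal_edges_def intro: exI[of _ 0])
        with up True show ?thesis by blast
      next
        case False
        with x cl[OF Suc.prems(2)] rin show ?thesis by blast
      qed
    qed (use up in blast)
  qed
  with operadic_treeD(12)[OF T y] y show ?thesis by blast
qed

lemma root_emb_funpow: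
  assumes S: "operadic_tree S" and f: "f \<in> root_embs S T" and x: "x \<in> edges S"
  shows "(parent T ^^ k) (f x) = f ((parent S ^^ k) x)"
proof (induction k)
  case (Suc k)
  then show ?case using f funpow_parent_in[OF S x, of k] by (simp add: root_embs_def)
qed simp

text \<open>The walk from \<open>f x\<close> to \<open>f l\<close> pulls back to a walk in
  \<open>S\<close> from \<open>x\<close> to the leaf \<open>l\<close>, which cannot have moved. So
  the image of \<open>S\<close> meets the ideal over \<open>f l\<close> only in
  \<open>f l\<close>.\<close>

lemma root_emb_ideal_eq:
  assumes S: "operadic_tree S" and f: "f \<in> root_embs S T" and x: "x \<in> edges S" and l: "l \<in> leaves S"
    and fx: "f x \<in> ideal_edges T (f l)"
  shows "x = l"
proof -
  obtain k where "f ((parent S ^^ k) x) = f l"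
    using fx root_emb_funpow[OF S f x] by (auto simp: ideal_edges_def)
  then have "(parent S ^^ k) x = l"
    using f funpow_parent_in[OF S x] l leaves_subset[of S] unfolding root_embs_def inj_on_def by blast
  then show ?thesis using funpow_parent_leaf[OF S x, of k] l by simp
qed

lemma root_emb_ideals_disjoint:
  assumes S: "operadic_tree S" and T: "operadic_tree T" and f: "f \<in> root_embs S T"
    and l: "l \<in> leaves S" "l' \<in> leaves S"
    and y: "y \<in> ideal_edges T (f l)" "y \<in> ideal_edges T (f l')"
  shows "l = l'"
proof -
  \<comment> \<open>Of two such edges on the walk from \<open>y\<close>, the one met first lies in
    the ideal over the other; the case \<open>i \<le> j\<close> suffices by symmetry.\<close>
  have *: "l = l'" if "(parent T ^^ i) y = f l" "(parent T ^^ j) y = f l'" "i \<le> j"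
    "l \<in> leaves S" "l' \<in> leaves S" for i j l l'
  proof -
    have l: "l \<in> edges S" using that leaves_subset by fast
    have "(parent T ^^ (j - i)) (f l) = f l'"
      using that(1-3) by (metis comp_apply funpow_add le_add_diff_inverse2)
    moreover have "f l \<in> edges T" using f l by (auto simp: root_embs_def)
    ultimately have "f l \<in> ideal_edges T (f l')" by (auto simp: ideal_edges_def)
    then show ?thesis using root_emb_ideal_eq[OF S f l] that by blast
  qed
  from y obtain i j where "(parent T ^^ i) y = f l" "(parent T ^^ j) y = f l'"
    by (auto simp: ideal_edges_def)
  with *[of i l j l'] *[of j l' i l] l show ?thesis by (cases "i \<le> j") auto
qed

lemma root_emb_leaf_cover:
  assumes S: "operadic_tree S" and T: "operadic_tree T" and f: "f \<in> root_embs S T"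
  shows "leaves T \<subseteq> (\<Union>l\<in>leaves S. ideal_edges T (f l))"
proof
  fix y assume y: "y \<in> leaves T"
  then have yT: "y \<in> edges T" using leaves_subset by fast
  show "y \<in> (\<Union>l\<in>leaves S. ideal_edges T (f l))"
    using root_emb_cover[OF S T f yT]
  proof
    assume "y \<in> f ` edges S"
    then obtain x where x: "x \<in> edges S" "y = f x" by blast
    then have "x \<in> leaves S" using f y by (auto simp: root_embs_def)
    moreover have "y \<in> ideal_edges T y" using yT by (auto simp: ideal_edges_def intro: exI[of _ 0])
    ultimately show ?thesis using x by blast
  qed blast
qed

section \<open>Decomposing isomorphisms out of a grafted tree\<close>

text \<open>The glued edge is recorded twice, in the first component at \<open>l\<close> and in the
  second at the root of \<open>Z l\<close>. The two values agree automatically for pairs in which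
  the second component maps \<open>Z l\<close> onto the ideal subtree rooted at the image of
  \<open>l\<close>.\<close>

definition graft_restrict ::
  "('a, 'k, 'l) tree_diagram \<Rightarrow> ('a \<Rightarrow> ('b, 'm, 'n) tree_diagram) \<Rightarrow> ('a + 'a \<times> 'b \<Rightarrow> 'c) \<Rightarrow>
   ('a \<Rightarrow> 'c) \<times> ('a \<Rightarrow> 'b \<Rightarrow> 'c)" where
  "graft_restrict S Z \<phi> =
     (\<lambda>x\<in>edges S. \<phi> (Inl x), \<lambda>l\<in>leaves S. \<lambda>y\<in>edges (Z l). \<phi> (graft_edge Z l y))"

lemma graft_edges_cases:
  assumes "z \<in> graft_edges S Z"
  obtains x where "z = Inl x" "x \<in> edges S"
  | l y where "z = graft_edge Z l y" "l \<in> leaves S" "y \<in> edges (Z l)"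
  using assms unfolding graft_edges_def by blast

lemma Inl_in_graft_edges: "x \<in> edges S \<Longrightarrow> Inl x \<in> graft_edges S Z"
  and graft_edge_in_graft_edges: "l \<in> leaves S \<Longrightarrow> y \<in> edges (Z l) \<Longrightarrow> graft_edge Z l y \<in> graft_edges S Z"
  unfolding graft_edges_def by blast+

context
  fixes S :: "('a, 'k, 'l) tree_diagram" and Z :: "'a \<Rightarrow> ('b, 'm, 'n) tree_diagram"
    and T :: "('c, 'p, 'q) tree_diagram"
  assumes S: "operadic_tree S" and Z: "\<And>l. l \<in> leaves S \<Longrightarrow> operadic_tree (Z l)"
    and T: "operadic_tree T"
begin

context
  fixes \<phi> assumes \<phi>: "\<phi> \<in> edge_isos (graft S Z) T"
begin

lemma graft_iso_facts:
  shows "inj_on \<phi> (graft_edges S Z)" "\<phi> ` graft_edges S Z = edges T" "\<phi> (Inl (root S)) = root T"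
    "\<phi> ` graft_leaves S Z = leaves T"
    "\<And>x. x \<in> graft_edges S Z \<Longrightarrow> \<phi> (graft_parent S Z x) = parent T (\<phi> x)"
    "\<And>x. x \<in> graft_edges S Z \<Longrightarrow> \<phi> x \<in> leaves T \<Longrightarrow> x \<in> graft_leaves S Z"
    "\<And>x. x \<in> graft_edges S Z \<Longrightarrow> graft_parent S Z x \<in> graft_edges S Z"
proof -
  note G = operadic_tree_graft[of S Z, OF S Z]
  show inj: "inj_on \<phi> (graft_edges S Z)" and "\<phi> ` graft_edges S Z = edges T"
    and "\<phi> (Inl (root S)) = root T" and lv: "\<phi> ` graft_leaves S Z = leaves T"
    and "\<And>x. x \<in> graft_edges S Z \<Longrightarrow> \<phi> (graft_parent S Z x) = parent T (\<phi> x)"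
    using \<phi> G(2,3,4) by (auto simp: edge_isos_def bij_betw_def)
  show "x \<in> graft_leaves S Z" if "x \<in> graft_edges S Z" "\<phi> x \<in> leaves T" for x
  proof -
    have "graft_leaves S Z \<subseteq> graft_edges S Z" using leaves_subset[of "graft S Z"] G(3) by simp
    from inj_on_image_mem_iff[OF inj that(1) this] that(2) lv show ?thesis by blast
  qed
  show "graft_parent S Z x \<in> graft_edges S Z" if "x \<in> graft_edges S Z" for x
    using operadic_tree_parent_in[of "graft S Z" x] G(1) G(4)[of x] that by simp
qed

lemma graft_restrict_fst: "fst (graft_restrict S Z \<phi>) \<in> root_embs S T"
proof -
  note \<phi>' = graft_iso_facts
  let ?f = "\<lambda>x\<in>edges S. \<phi> (Inl x)"
  have "inj_on ?f (edges S)"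
    using inj_onD[OF \<phi>'(1)] by (auto simp: inj_on_def dest: Inl_in_graft_edges)
  moreover have "?f ` edges S \<subseteq> edges T" using \<phi>'(2) by (auto dest: Inl_in_graft_edges)
  moreover have "?f (parent S x) = parent T (?f x)" if "x \<in> edges S" for x
    using that \<phi>'(5)[OF Inl_in_graft_edges[OF that]] operadic_tree_parent_in[OF S that] by simp
  moreover have "x \<in> leaves S" if "x \<in> edges S" "?f x \<in> leaves T" for x
  proof -
    have "Inl x \<in> graft_leaves S Z" using that \<phi>'(6)[OF Inl_in_graft_edges] by simp
    then show ?thesis by (auto simp: graft_leaves_def graft_edge_eq_Inl dest!: sym[of "Inl x"])
  qed
  moreover have "y \<in> ?f ` edges S"
    if y: "y \<in> edges T" "y \<noteq> root T" and p: "parent T y \<in> ?f ` (edges S - leaves S)" for y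
  proof -
    obtain x where x: "x \<in> edges S" "x \<notin> leaves S" "parent T y = \<phi> (Inl x)" using p by auto
    obtain z where z: "z \<in> graft_edges S Z" "y = \<phi> z" using y(1) \<phi>'(2) by blast
    have gp: "graft_parent S Z z = Inl x"
      using x z \<phi>'(5)[OF z(1)] inj_onD[OF \<phi>'(1) _ \<phi>'(7)[OF z(1)] Inl_in_graft_edges[OF x(1)]] by simp
    from z(1) show ?thesis
    proof (cases rule: graft_edges_cases)
      case (1 x')
      with z show ?thesis by auto
    next
      case (2 l w)
      \<comment> \<open>Otherwise the parent of this edge would again come from \<open>Z l\<close>;
        being equal to \<open>Inl x\<close>, it would make \<open>x\<close> the leaf
        \<open>l\<close>.\<close>
      have "w = root (Z l)"
      proof (rule ccontr)
        assume "w \<noteq> root (Z l)"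
        then have "graft_edge Z l (parent (Z l) w) = Inl x"
          using gp 2(1) by (simp add: graft_parent_graft_edge)
        with x(2) 2(2) show False by (simp add: graft_edge_eq_Inl)
      qed
      with 2 z leaves_subset[of S] show ?thesis by auto
    qed
  qed
  ultimately show ?thesis
    using \<phi>'(3) operadic_treeD(9)[OF S] by (auto simp: graft_restrict_def root_embs_def)
qed

lemma graft_iso_funpow:
  assumes "x \<in> graft_edges S Z"
  shows "(parent T ^^ k) (\<phi> x) = \<phi> ((graft_parent S Z ^^ k) x)" "(graft_parent S Z ^^ k) x \<in> graft_edges S Z"
  by (induction k) (use assms graft_iso_facts(5,7) in auto)

text \<open>In the grafted tree the edges with a walk to \<open>Inl l\<close> are exactly those of
  \<open>Z l\<close>: walks from the rest of \<open>S\<close> or from another \<open>Z l'\<close>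
  never meet \<open>l\<close>. The isomorphism carries this set to the ideal over the image of
  \<open>l\<close>.\<close>

lemma graft_restrict_snd:
  assumes l: "l \<in> leaves S"
  shows "snd (graft_restrict S Z \<phi>) l \<in>
    edge_isos (Z l) (ideal_subtree T (fst (graft_restrict S Z \<phi>) l))"
proof -
  note \<phi>' = graft_iso_facts
  have lS: "l \<in> edges S" using l leaves_subset by fast
  note Zl = operadic_treeD[OF Z[OF l]]
  let ?t = "\<phi> (Inl l)" and ?g = "\<lambda>y\<in>edges (Z l). \<phi> (graft_edge Z l y)"
  have tT: "?t \<in> edges T" using \<phi>'(2) Inl_in_graft_edges[OF lS] by blast
  have ge: "graft_edge Z l y \<in> graft_edges S Z" if "y \<in> edges (Z l)" for y
    unfolding graft_edges_def using l that by blast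
  have inj: "inj_on ?g (edges (Z l))"
    by (rule inj_onI) (use inj_onD[OF \<phi>'(1)] ge in force)
  have im: "?g ` edges (Z l) = ideal_edges T ?t"
  proof (intro subset_antisym subsetI)
    fix z assume "z \<in> ?g ` edges (Z l)"
    then obtain y where y: "y \<in> edges (Z l)" "z = \<phi> (graft_edge Z l y)" by auto
    obtain k where "(graft_parent S Z ^^ k) (graft_edge Z l y) = Inl l"
      using graft_parent_reach[of Z l y S] Z[OF l] y by blast
    then have "(parent T ^^ k) z = ?t" using graft_iso_funpow(1)[OF ge[OF y(1)], of k] y by simp
    moreover have "z \<in> edges T" using ge y \<phi>'(2) by blast
    ultimately show "z \<in> ideal_edges T ?t" by (auto simp: ideal_edges_def)
  next
    fix z assume "z \<in> ideal_edges T ?t"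
    then obtain k where k: "(parent T ^^ k) z = ?t" "z \<in> edges T" by (auto simp: ideal_edges_def)
    then obtain w where w: "w \<in> graft_edges S Z" "z = \<phi> w" using \<phi>'(2) by blast
    have pw: "(graft_parent S Z ^^ k) w = Inl l"
      using k(1) w graft_iso_funpow[OF w(1), of k] inj_onD[OF \<phi>'(1) _ _ Inl_in_graft_edges[OF lS]]
      by auto
    from w(1) show "z \<in> ?g ` edges (Z l)"
    proof (cases rule: graft_edges_cases)
      case (1 x)
      then have "(parent S ^^ k) x = l" using pw by (simp add: graft_parent_funpow_Inl)
      then have "x = l" using funpow_parent_leaf[OF S 1(2), of k] l by simp
      with 1 w Zl(9) show ?thesis by (auto intro!: image_eqI[of _ _ "root (Z l)"])
    next
      case (2 l' y)
      then have "l' = l" using graft_parent_funpow_leaf[OF S l 2(2), where Z = Z and k = k and w = y] pw by simp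
      with 2 w show ?thesis by auto
    qed
  qed
  have lv: "?g ` leaves (Z l) = leaves (ideal_subtree T ?t)"
  proof -
    have "?g y \<in> leaves T \<longleftrightarrow> y \<in> leaves (Z l)" if "y \<in> edges (Z l)" for y
    proof -
      have "?g y \<in> leaves T \<longleftrightarrow> graft_edge Z l y \<in> graft_leaves S Z"
        using that \<phi>'(4) \<phi>'(6)[OF ge[OF that]] by auto
      then show ?thesis using l by (auto simp: graft_leaves_def)
    qed
    then show ?thesis
      unfolding leaves_ideal_subtree im[symmetric] using leaves_subset[of "Z l"] by blast
  qed
  have root: "?g (root (Z l)) = root (ideal_subtree T ?t)"
    using Zl(9) operadic_tree_ideal_subtree(2)[OF T tT] by simp
  have "?g (parent (Z l) y) = parent (ideal_subtree T ?t) (?g y)" if y: "y \<in> edges (Z l)" for y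
  \<comment> \<open>At the root both parent maps are stationary; elsewhere the parent in the ideal
    subtree is the parent in \<open>T\<close>.\<close>
  proof (cases "y = root (Z l)")
    case True
    then show ?thesis using root by (metis parent_root)
  next
    case False
    have "?g y \<noteq> ?t" using inj_onD[OF inj _ y Zl(9)] Zl(9) False by auto
    moreover have "?g y \<in> ideal_edges T ?t" using im y by blast
    ultimately have "parent (ideal_subtree T ?t) (?g y) = parent T (?g y)"
      using parent_ideal_subtree[OF T tT] by blast
    also have "\<dots> = \<phi> (graft_parent S Z (graft_edge Z l y))" using y \<phi>'(5)[OF ge[OF y]] by simp
    also have "\<dots> = ?g (parent (Z l) y)"
      using False operadic_tree_parent_in[OF Z[OF l] y] by (simp add: graft_parent_graft_edge)
    finally show ?thesis by simp
  qed
  with inj im lv root have "?g \<in> edge_isos (Z l) (ideal_subtree T ?t)"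
    by (auto simp: edge_isos_def bij_betw_def simp del: restrict_apply)
  with l lS show ?thesis by (simp add: graft_restrict_def)
qed

end

section \<open>Reassembling an isomorphism from its pieces\<close>

text \<open>At the shared edge \<open>Inl l\<close> the value is taken from \<open>f\<close>; it
  agrees with the value of \<open>g l\<close> at the root of \<open>Z l\<close> once
  \<open>g l\<close> is an isomorphism onto the ideal subtree rooted at \<open>f l\<close>.\<close>

definition glue :: "('a \<Rightarrow> 'c) \<Rightarrow> ('a \<Rightarrow> 'b \<Rightarrow> 'c) \<Rightarrow> 'a + 'a \<times> 'b \<Rightarrow> 'c" where
  "glue f g = (\<lambda>z\<in>graft_edges S Z. case z of Inl x \<Rightarrow> f x | Inr (l, y) \<Rightarrow> g l y)"

context
  fixes f g
  assumes f: "f \<in> root_embs S T"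
    and g: "g \<in> (\<Pi>\<^sub>E l\<in>leaves S. edge_isos (Z l) (ideal_subtree T (f l)))"
begin

lemma leaf_image_in: "l \<in> leaves S \<Longrightarrow> f l \<in> edges T"
  using f leaves_subset[of S] by (auto simp: root_embs_def)

lemma glue_data:
  assumes "l \<in> leaves S"
  shows "inj_on (g l) (edges (Z l))" "g l ` edges (Z l) = ideal_edges T (f l)" "g l (root (Z l)) = f l"
    "g l ` leaves (Z l) = leaves T \<inter> ideal_edges T (f l)"
    "\<And>y. y \<in> edges (Z l) \<Longrightarrow> y \<noteq> root (Z l) \<Longrightarrow> g l (parent (Z l) y) = parent T (g l y)"
proof -
  note r = operadic_tree_ideal_subtree(2)[OF T leaf_image_in[OF assms]]
  have "g l \<in> edge_isos (Z l) (ideal_subtree T (f l))" using g assms by auto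
  then show inj: "inj_on (g l) (edges (Z l))" and im: "g l ` edges (Z l) = ideal_edges T (f l)"
    and root: "g l (root (Z l)) = f l" and "g l ` leaves (Z l) = leaves T \<inter> ideal_edges T (f l)"
    using r by (auto simp: edge_isos_def bij_betw_def leaves_ideal_subtree)
  have par: "g l (parent (Z l) y) = parent (ideal_subtree T (f l)) (g l y)" if "y \<in> edges (Z l)" for y
    using g assms that by (auto simp: edge_isos_def PiE_iff)
  show "g l (parent (Z l) y) = parent T (g l y)" if y: "y \<in> edges (Z l)" "y \<noteq> root (Z l)" for y
  proof -
    have "g l y \<noteq> f l" using inj_onD[OF inj _ y(1) operadic_treeD(9)[OF Z[OF assms]]] y(2) root by auto
    with par[OF y(1)] parent_ideal_subtree[OF T leaf_image_in[OF assms]] im y(1) show ?thesis by auto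
  qed
qed

lemma glue_Inl: "x \<in> edges S \<Longrightarrow> glue f g (Inl x) = f x"
  by (simp add: glue_def Inl_in_graft_edges)

lemma glue_graft_edge: "l \<in> leaves S \<Longrightarrow> y \<in> edges (Z l) \<Longrightarrow> glue f g (graft_edge Z l y) = g l y"
  using glue_data(3)[of l] graft_edge_in_graft_edges[of l S y Z]
  by (auto simp: glue_def graft_edge_def)

text \<open>The image of \<open>S\<close> and the ideals over its leaves cover \<open>T\<close>,
  distinct ideals are disjoint, and the image of \<open>S\<close> meets each ideal only in its root,
  which is precisely the identification made in the grafted tree.\<close>

lemma glue_in_edge_isos: "glue f g \<in> edge_isos (graft S Z) T"
proof -
  note G = operadic_tree_graft[of S Z, OF S Z]
  have injf: "inj_on f (edges S)" using f by (simp add: root_embs_def)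
  have lf: "l \<in> edges S" if "l \<in> leaves S" for l using that leaves_subset by fast
  have im: "glue f g ` graft_edges S Z = f ` edges S \<union> (\<Union>l\<in>leaves S. ideal_edges T (f l))"
    unfolding graft_edges_def image_Un image_UN image_image
    by (intro arg_cong2[of _ _ _ _ "(\<union>)"] SUP_cong refl)
      (simp_all add: glue_Inl glue_graft_edge glue_data(2)[symmetric] cong: image_cong)
  also have "\<dots> = edges T"
  proof (intro subset_antisym subsetI)
    fix y assume "y \<in> edges T"
    from root_emb_cover[OF S T f this]
    show "y \<in> f ` edges S \<union> (\<Union>l\<in>leaves S. ideal_edges T (f l))" by blast
  qed (use f in \<open>auto simp: root_embs_def ideal_edges_def\<close>)
  finally have im: "glue f g ` graft_edges S Z = edges T" .
  have lv: "glue f g ` graft_leaves S Z = leaves T"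
  proof -
    have "glue f g ` graft_leaves S Z = (\<Union>l\<in>leaves S. leaves T \<inter> ideal_edges T (f l))"
      unfolding graft_leaves_def image_UN image_image
      by (intro SUP_cong refl)
        (simp add: glue_graft_edge glue_data(4)[symmetric] subsetD[OF leaves_subset] cong: image_cong)
    with root_emb_leaf_cover[OF S T f] show ?thesis by auto
  qed
  \<comment> \<open>The only overlap between the part from \<open>S\<close> and the part from
    \<open>Z l\<close> is the glued edge.\<close>
  have mixed: "Inl x = graft_edge Z l y"
    if "x \<in> edges S" "l \<in> leaves S" "y \<in> edges (Z l)" "f x = g l y" for x l y
  proof -
    have "f x \<in> ideal_edges T (f l)" using that glue_data(2)[OF that(2)] by auto
    then have "x = l" using root_emb_ideal_eq[OF S f] that by blast
    then have "g l y = g l (root (Z l))" using that glue_data(3)[OF that(2)] by simp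
    then have "y = root (Z l)"
      using inj_onD[OF glue_data(1)[OF that(2)]] that(3) operadic_treeD(9)[OF Z[OF that(2)]] by blast
    with \<open>x = l\<close> show ?thesis by simp
  qed
  have inj: "inj_on (glue f g) (graft_edges S Z)"
  proof (rule inj_onI)
    fix z z' assume z: "z \<in> graft_edges S Z" and z': "z' \<in> graft_edges S Z"
      and eq: "glue f g z = glue f g z'"
    from z show "z = z'"
    proof (cases rule: graft_edges_cases)
      case 1: (1 x)
      from z' show ?thesis
      proof (cases rule: graft_edges_cases)
        case (1 x')
        with \<open>z = Inl x\<close> \<open>x \<in> edges S\<close> eq injf show ?thesis by (auto simp: glue_Inl dest: inj_onD)
      next
        case (2 l y)
        with 1 eq mixed show ?thesis by (simp add: glue_Inl glue_graft_edge)
      qed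
    next
      case 2: (2 l y)
      from z' show ?thesis
      proof (cases rule: graft_edges_cases)
        case (1 x)
        with 2 eq mixed[of x l y] show ?thesis by (simp add: glue_Inl glue_graft_edge)
      next
        case (2 l' y')
        note l = \<open>l \<in> leaves S\<close> and y = \<open>y \<in> edges (Z l)\<close>
        have e: "g l y = g l' y'" using eq 2 \<open>z = graft_edge Z l y\<close> l y by (simp add: glue_graft_edge)
        have "g l y \<in> ideal_edges T (f l)" using glue_data(2)[OF l] y by blast
        moreover have "g l y \<in> ideal_edges T (f l')"
          unfolding e using glue_data(2)[OF 2(2)] 2(3) by blast
        ultimately have "l = l'" using root_emb_ideals_disjoint[OF S T f l 2(2)] by blast
        with e 2 y inj_onD[OF glue_data(1)[OF l]] \<open>z = graft_edge Z l y\<close> show ?thesis by blast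
      qed
    qed
  qed
  have par: "glue f g (graft_parent S Z z) = parent T (glue f g z)" if "z \<in> graft_edges S Z" for z
  proof -
    have Inl: "glue f g (graft_parent S Z (Inl x)) = parent T (glue f g (Inl x))" if "x \<in> edges S" for x
      using that f operadic_tree_parent_in[OF S that] by (simp add: glue_Inl root_embs_def)
    from \<open>z \<in> graft_edges S Z\<close> show ?thesis
    proof (cases rule: graft_edges_cases)
      case (2 l y)
      show ?thesis
      proof (cases "y = root (Z l)")
        case False
        then show ?thesis
          using 2 glue_data(5)[OF 2(2,3)] operadic_tree_parent_in[OF Z 2(3)]
          by (simp add: graft_parent_graft_edge glue_graft_edge)
      qed (use 2 Inl lf in auto)
    qed (use Inl in simp)
  qed
  show ?thesis
    unfolding edge_isos_def
    using inj im lv par G(2,3,4) f operadic_treeD(9)[OF S]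
    by (auto simp: bij_betw_def glue_Inl root_embs_def) (simp add: glue_def)
qed

lemma graft_restrict_glue: "graft_restrict S Z (glue f g) = (f, g)"
proof -
  have "(\<lambda>x\<in>edges S. glue f g (Inl x)) = f"
    by (rule extensionalityI[of _ "edges S"]) (use f in \<open>auto simp: root_embs_def glue_Inl\<close>)
  moreover have "(\<lambda>l\<in>leaves S. \<lambda>y\<in>edges (Z l). glue f g (graft_edge Z l y)) = g"
  proof (rule extensionalityI[of _ "leaves S"])
    fix l assume l: "l \<in> leaves S"
    then have "g l \<in> extensional (edges (Z l))" using g by (auto simp: edge_isos_def)
    then have "(\<lambda>y\<in>edges (Z l). glue f g (graft_edge Z l y)) = g l"
      by (intro extensionalityI[of _ "edges (Z l)"]) (auto simp: glue_graft_edge l)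
    with l show "(\<lambda>l\<in>leaves S. \<lambda>y\<in>edges (Z l). glue f g (graft_edge Z l y)) l = g l" by simp
  qed (use g in \<open>auto simp: PiE_iff\<close>)
  ultimately show ?thesis by (simp add: graft_restrict_def)
qed

end

text \<open>Injective since every grafted edge comes from \<open>S\<close> or from some
  \<open>Z l\<close>; surjective by gluing. This is the bijection behind the whole count.\<close>

lemma bij_betw_graft_restrict:
  "bij_betw (graft_restrict S Z) (edge_isos (graft S Z) T)
     (SIGMA f:root_embs S T. \<Pi>\<^sub>E l\<in>leaves S. edge_isos (Z l) (ideal_subtree T (f l)))"
  unfolding bij_betw_def
proof (intro conjI subset_antisym subsetI)
  show "inj_on (graft_restrict S Z) (edge_isos (graft S Z) T)"
  proof (rule inj_onI)
    fix \<phi> \<psi> assume \<phi>: "\<phi> \<in> edge_isos (graft S Z) T" and \<psi>: "\<psi> \<in> edge_isos (graft S Z) T"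
      and eq: "graft_restrict S Z \<phi> = graft_restrict S Z \<psi>"
    show "\<phi> = \<psi>"
    proof (rule extensionalityI[of _ "graft_edges S Z"])
      fix z assume "z \<in> graft_edges S Z"
      then show "\<phi> z = \<psi> z"
      proof (cases rule: graft_edges_cases)
        case (1 x)
        from eq have "(\<lambda>x\<in>edges S. \<phi> (Inl x)) = (\<lambda>x\<in>edges S. \<psi> (Inl x))"
          by (simp add: graft_restrict_def)
        from fun_cong[OF this, of x] 1 show ?thesis by simp
      next
        case (2 l y)
        from eq have "(\<lambda>l\<in>leaves S. \<lambda>y\<in>edges (Z l). \<phi> (graft_edge Z l y)) =
            (\<lambda>l\<in>leaves S. \<lambda>y\<in>edges (Z l). \<psi> (graft_edge Z l y))"
          by (simp add: graft_restrict_def)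
        from fun_cong[OF fun_cong[OF this, of l], of y] 2 show ?thesis by simp
      qed
    qed (use \<phi> \<psi> in \<open>auto simp: edge_isos_def\<close>)
  qed
next
  fix p assume "p \<in> graft_restrict S Z ` edge_isos (graft S Z) T"
  then obtain \<phi> where \<phi>: "\<phi> \<in> edge_isos (graft S Z) T" and p: "p = graft_restrict S Z \<phi>" by blast
  have "snd p \<in> extensional (leaves S)" by (simp add: p graft_restrict_def)
  then show "p \<in> (SIGMA f:root_embs S T. \<Pi>\<^sub>E l\<in>leaves S. edge_isos (Z l) (ideal_subtree T (f l)))"
    using graft_restrict_fst[OF \<phi>] graft_restrict_snd[OF \<phi>] p
    by (cases p) (auto simp: PiE_iff dest: sym)
next
  fix p assume "p \<in> (SIGMA f:root_embs S T. \<Pi>\<^sub>E l\<in>leaves S. edge_isos (Z l) (ideal_subtree T (f l)))"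
  then obtain f g where p: "p = (f, g)" and fg: "f \<in> root_embs S T"
    "g \<in> (\<Pi>\<^sub>E l\<in>leaves S. edge_isos (Z l) (ideal_subtree T (f l)))" by blast
  show "p \<in> graft_restrict S Z ` edge_isos (graft S Z) T"
    using glue_in_edge_isos[OF fg] graft_restrict_glue[OF fg] p by (metis imageI)
qed

end

section \<open>Counting\<close>

lemma class_of_eq_iff:
  assumes "operadic_tree T"
  shows "edge_isos (rep X) T \<noteq> {} \<longleftrightarrow> class_of T = X"
proof -
  have "tree_rel (rep X) T \<longleftrightarrow> class_of (rep X) = class_of T"
    using Quotient_rel[OF Quotient_tree_class, of "rep X" T] operadic_tree_rep[of X] assms tree_iso_refl
    unfolding tree_rel_def by blast
  then show ?thesis
    using tree_rel_iff_edge_isos[of "rep X" T] assms operadic_tree_rep[of X]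
      Quotient_abs_rep[OF Quotient_tree_class, of X] by auto
qed

lemma card_edge_isos_rep:
  assumes "operadic_tree T"
  shows "card (edge_isos (rep X) T) = (if class_of T = X then card (Aut (rep X)) else 0)"
proof (cases "edge_isos (rep X) T = {}")
  case False
  with card_edge_isos(2)[OF operadic_tree_rep assms] class_of_eq_iff[OF assms]
  show ?thesis by (simp add: card_Aut[OF operadic_tree_rep])
qed (use class_of_eq_iff[OF assms] in auto)

text \<open>A grafted tree does not have natural numbers as edges, so \<open>class_of\<close> does
  not apply to it directly; a model on natural numbers supplies its class. The conclusion is phrased
  by cardinalities because sums over \<open>X'\<close> are taken later.\<close>

lemma ex_tree_class:
  assumes T: "operadic_tree T"
  obtains X where "\<And>X'. card (edge_isos T (rep X')) = (if X' = X then card (Aut (rep X')) else 0)"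
proof -
  obtain T' f where T': "operadic_tree T'" and "T' \<in> bounded_trees (card (edges T))"
    and f: "tree_iso T T' f"
    by (rule operadic_tree_nat_model[OF T order_refl])
  have h: "fst f \<in> edge_isos T T'" using tree_iso_imp_edge_iso[OF T T'] f by (cases f) auto
  note h' = edge_isos_inverse[OF h T T']
  have "edge_isos T (rep X') \<noteq> {} \<longleftrightarrow> X' = class_of T'" for X'
  proof -
    have "edge_isos T (rep X') \<noteq> {} \<longleftrightarrow> edge_isos T' (rep X') \<noteq> {}"
      using edge_isos_comp[OF h _ T] edge_isos_comp[OF h' _ T'] by blast
    also have "\<dots> \<longleftrightarrow> edge_isos (rep X') T' \<noteq> {}"
      using edge_isos_inverse T' operadic_tree_rep by blast
    finally show ?thesis using class_of_eq_iff[OF T'] by auto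
  qed
  then have "card (edge_isos T (rep X')) = (if X' = class_of T' then card (Aut (rep X')) else 0)" for X'
    using card_edge_isos(1)[OF T operadic_tree_rep, of X'] card_Aut[OF operadic_tree_rep, of X']
    by (metis card.empty)
  then show ?thesis by (rule that)
qed

section \<open>Decorations by trees with a prescribed product\<close>

definition decorations :: "'i set \<Rightarrow> forest \<Rightarrow> ('i \<Rightarrow> tree_class) set" where
  "decorations I F = {Z \<in> I \<rightarrow>\<^sub>E UNIV. image_mset Z (mset_set I) = F}"

text \<open>Only the automorphisms of the individual trees are counted, not permutations of equal
  trees; those are accounted for by the number of decorations.\<close>

definition forest_aut :: "forest \<Rightarrow> nat" where
  "forest_aut F = (\<Prod>X\<in>#F. card (Aut (rep X)))"

lemma forest_aut_pos: "forest_aut F > 0"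
  unfolding forest_aut_def using finite_Aut(2)[OF operadic_tree_rep] by (induction F) auto

lemma finite_decorations:
  assumes "finite I"
  shows "finite (decorations I F)"
proof (rule finite_subset)
  show "decorations I F \<subseteq> I \<rightarrow>\<^sub>E set_mset F"
    using assms by (auto simp: decorations_def PiE_def extensional_def)
qed (use assms in \<open>simp add: finite_PiE\<close>)

text \<open>Split by the label of \<open>i\<close>. Each tree occurring in \<open>F\<close> is taken
  once, whatever its multiplicity, which matches the recursion in
  \<open>series_mult_green\<close>.\<close>

lemma card_decorations_insert:
  assumes I: "finite I" "i \<notin> I"
  shows "card (decorations (insert i I) F) = (\<Sum>X\<in>set_mset F. card (decorations I (F - {#X#})))"
proof -
  let ?h = "\<lambda>(X, Z). Z(i := X)"
  have img: "image_mset (Z(i := X)) (mset_set I) = image_mset Z (mset_set I)" for X Z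
    using I by (intro image_mset_cong) auto
  have "bij_betw ?h (SIGMA X:set_mset F. decorations I (F - {#X#})) (decorations (insert i I) F)"
  \<comment> \<open>The inverse reads off the label at \<open>i\<close> and resets it to
    \<open>undefined\<close>, as extensionality on \<open>I\<close> requires.\<close>
  proof (rule bij_betw_byWitness[where f' = "\<lambda>Z. (Z i, Z(i := undefined))"])
    show "\<forall>p\<in>SIGMA X:set_mset F. decorations I (F - {#X#}). ((\<lambda>Z. (Z i, Z(i := undefined))) (?h p)) = p"
      using I(2) by (auto simp: decorations_def PiE_iff extensional_def fun_eq_iff)
    show "?h ` (SIGMA X:set_mset F. decorations I (F - {#X#})) \<subseteq> decorations (insert i I) F"
      using I by (auto simp: decorations_def PiE_iff extensional_def img)
    show "(\<lambda>Z. (Z i, Z(i := undefined))) ` decorations (insert i I) F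
        \<subseteq> (SIGMA X:set_mset F. decorations I (F - {#X#}))"
      using I by (auto simp: decorations_def PiE_iff extensional_def img)
  qed auto
  then have "card (decorations (insert i I) F) = card (SIGMA X:set_mset F. decorations I (F - {#X#}))"
    using bij_betw_same_card by metis
  then show ?thesis using finite_decorations[OF I(1)] by simp
qed

section \<open>Coefficients of the Green function and of its powers\<close>

lemma green_term_eq:
  "green_term X m = (if m = {#X#} then 1 / of_nat (card (Aut (rep X))) else 0 :: 'k::field_char_0)"
  by (auto simp: green_term_def lookup_single when_def)

lemma green_singleton: "green {#X#} = (1 / of_nat (card (Aut (rep X))) :: 'k::field_char_0)"
proof -
  have "{Y. green_term Y {#X#} \<noteq> (0::'k)} = {X}"
    using finite_Aut(2)[OF operadic_tree_rep, of X] by (auto simp: green_term_eq)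
  then show ?thesis by (simp add: green_def formal_sum_def green_term_eq)
qed

lemma green_eq_0: "(\<And>X. m \<noteq> {#X#}) \<Longrightarrow> green m = (0 :: 'k::field_char_0)"
  by (simp add: green_def formal_sum_def green_term_eq)

lemma green_leaves_singleton:
  "green_leaves n {#X#} = (if card (leaves (rep X)) = n then green {#X#} else 0 :: 'k::field_char_0)"
proof -
  have "{Y \<in> {Y. card (leaves (rep Y)) = n}. green_term Y {#X#} \<noteq> (0::'k)} =
      (if card (leaves (rep X)) = n then {X} else {})"
    using finite_Aut(2)[OF operadic_tree_rep, of X] by (auto simp: green_term_eq)
  then show ?thesis by (simp add: green_leaves_def formal_sum_def green_term_eq green_singleton)
qed

lemma green_leaves_eq_0: "(\<And>X. m \<noteq> {#X#}) \<Longrightarrow> green_leaves n m = (0 :: 'k::field_char_0)"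
  by (simp add: green_leaves_def formal_sum_def green_term_eq)

text \<open>The Green function vanishes off single trees, so a splitting of \<open>F\<close>
  contributes only if its first part is one tree, and that tree determines the splitting.\<close>

lemma series_mult_green:
  "series_mult green P F =
     (\<Sum>X\<in>set_mset F. green {#X#} * P (F - {#X#}) :: 'k::field_char_0)"
proof -
  have "series_mult green P F = (\<Sum>(a, b)\<in>(\<lambda>X. ({#X#}, F - {#X#})) ` set_mset F. green a * P b)"
    unfolding series_mult_def
  proof (rule sum.mono_neutral_right[OF finite_series_mult])
    show "\<forall>p\<in>{(a, b). a + b = F} - (\<lambda>X. ({#X#}, F - {#X#})) ` set_mset F.
        (case p of (a, b) \<Rightarrow> green a * P b) = 0"
    proof clarify
      fix a b assume F: "F = a + b"
        and n: "(a, b) \<notin> (\<lambda>X. ({#X#}, a + b - {#X#})) ` set_mset (a + b)"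
      have "a \<noteq> {#X#}" for X using n by (auto simp: image_iff)
      then show "green a * P b = 0" by (simp add: green_eq_0)
    qed
  qed auto
  also have "\<dots> = (\<Sum>X\<in>set_mset F. green {#X#} * P (F - {#X#}))"
    by (subst sum.reindex) (auto simp: inj_on_def)
  finally show ?thesis .
qed

text \<open>Expanding the power chooses a tree for each element of \<open>I\<close>, each with
  weight one over its number of automorphisms. Induction runs over the set \<open>I\<close> so that
  it can be applied to the leaves of a tree.\<close>

lemma series_power_green:
  assumes "finite I"
  shows "series_power green (card I) F =
    (of_nat (card (decorations I F)) / of_nat (forest_aut F) :: 'k::field_char_0)"
  using assms
proof (induction I arbitrary: F rule: finite_induct)
  case empty
  \<comment> \<open>The empty decoration has the empty forest as product, in accordance with the
    unit series as the zeroth power.\<close>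
  have "decorations {} F = (if F = {#} then {\<lambda>_. undefined} else {} :: ('a \<Rightarrow> tree_class) set)"
    by (auto simp: decorations_def)
  then show ?case by (auto simp: lookup_one when_def forest_aut_def)
next
  case (insert i I)
  \<comment> \<open>Taking \<open>X\<close> out of \<open>F\<close> loses one factor of
    \<open>forest_aut\<close>, which the coefficient of the Green function at \<open>X\<close>
    restores.\<close>
  have "green {#X#} * series_power green (card I) (F - {#X#}) =
      (of_nat (card (decorations I (F - {#X#}))) / of_nat (forest_aut F) :: 'k)" if "X \<in># F" for X
  proof -
    from that obtain F' where "F = add_mset X F'" by (rule mset_add)
    then show ?thesis by (simp add: green_singleton insert.IH forest_aut_def)
  qed
  then show ?case
    using insert.hyps
    by (simp add: series_mult_green card_decorations_insert sum_divide_distrib)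
qed

section \<open>Double counting of cuts and decorations\<close>

lemma card_edge_isos_graft:
  assumes S: "operadic_tree S" and Z: "\<And>l. l \<in> leaves S \<Longrightarrow> operadic_tree (Z l)" and T: "operadic_tree T"
  shows "card (edge_isos (graft S Z) T) =
    (\<Sum>f\<in>root_embs S T. \<Prod>l\<in>leaves S. card (edge_isos (Z l) (ideal_subtree T (f l))))"
proof -
  have fin: "finite (root_embs S T)"
    unfolding root_embs_eq_UN_cuts[OF S T]
    using finite_cuts[OF T] finite_edge_isos[OF S cutsD(1)[OF T]] by blast
  have fl: "f l \<in> edges T" if "f \<in> root_embs S T" "l \<in> leaves S" for f l
    using that leaves_subset[of S] by (auto simp: root_embs_def)
  have "finite (edge_isos (Z l) (ideal_subtree T (f l)))" if "f \<in> root_embs S T" "l \<in> leaves S" for f l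
    using finite_edge_isos[OF Z operadic_tree_ideal_subtree(1)[OF T fl]] that by blast
  then have "\<forall>f\<in>root_embs S T. finite (\<Pi>\<^sub>E l\<in>leaves S. edge_isos (Z l) (ideal_subtree T (f l)))"
    using finite_leaves[OF S] by (auto intro!: finite_PiE)
  with fin show ?thesis
    using bij_betw_same_card[OF bij_betw_graft_restrict[of S Z T, OF S Z T]]
    by (simp add: card_PiE[OF finite_leaves[OF S]])
qed

text \<open>
  Both sides count the triples of a cut of \<open>rep X\<close>, an isomorphism from \<open>rep Y\<close> to it, and
  isomorphisms from trees \<open>rep (Z l)\<close> to the ideal subtrees over its leaves.
\<close>

lemma sum_card_edge_isos_graft:
  "(\<Sum>Z\<in>decorations (leaves (rep Y)) F. card (edge_isos (graft (rep Y) (rep \<circ> Z)) (rep X))) =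
    card {S \<in> cuts (rep X). pruned (rep X) S = F \<and> class_of S = Y} * card (Aut (rep Y)) * forest_aut F"
proof -
  let ?T = "rep X" and ?S = "rep Y" and ?D = "decorations (leaves (rep Y)) F"
  have T: "operadic_tree ?T" and S: "operadic_tree ?S" by (rule operadic_tree_rep)+
  note finL = finite_leaves[OF S]
  define c where "c f l = class_of (ideal_subtree ?T (f l))" for f and l :: nat
  have inner: "(\<Sum>Z\<in>?D. \<Prod>l\<in>leaves ?S. card (edge_isos (rep (Z l)) (ideal_subtree ?T (f l)))) =
      (if image_mset (c f) (mset_set (leaves ?S)) = F then forest_aut F else 0)"
    if f: "f \<in> root_embs ?S ?T" for f
  proof -
    have fl: "f l \<in> edges ?T" if "l \<in> leaves ?S" for l
      using that f leaves_subset[of ?S] by (auto simp: root_embs_def)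
    \<comment> \<open>For fixed \<open>f\<close> a single decoration can contribute, the one
      labelling each leaf with the class of the ideal subtree over its image; a wrong label gives a
      factor with no isomorphisms.\<close>
    have prod: "(\<Prod>l\<in>leaves ?S. card (edge_isos (rep (Z l)) (ideal_subtree ?T (f l)))) =
        (if Z = restrict (c f) (leaves ?S) then forest_aut F else 0)" if Z: "Z \<in> ?D" for Z
    proof -
      have card: "card (edge_isos (rep (Z l)) (ideal_subtree ?T (f l))) =
          (if Z l = c f l then card (Aut (rep (Z l))) else 0)" if "l \<in> leaves ?S" for l
        using card_edge_isos_rep[OF operadic_tree_ideal_subtree(1)[OF T fl[OF that]]]
        by (auto simp: c_def)
      show ?thesis
      proof (cases "Z = restrict (c f) (leaves ?S)")
        case True
        have "(\<Prod>l\<in>leaves ?S. card (edge_isos (rep (Z l)) (ideal_subtree ?T (f l)))) =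
            (\<Prod>l\<in>leaves ?S. card (Aut (rep (Z l))))"
          by (intro prod.cong refl, subst card) (simp_all add: True)
        also have "\<dots> = forest_aut F"
          using Z by (auto simp: forest_aut_def decorations_def prod_unfold_prod_mset
              image_mset.compositionality comp_def)
        finally show ?thesis using True by simp
      next
        case False
        have "\<exists>l\<in>leaves ?S. Z l \<noteq> c f l"
        proof (rule ccontr)
          assume "\<not> (\<exists>l\<in>leaves ?S. Z l \<noteq> c f l)"
          then have "Z = restrict (c f) (leaves ?S)"
            using Z by (intro extensionalityI[of _ "leaves ?S"]) (auto simp: decorations_def PiE_iff)
          with False show False ..
        qed
        then obtain l where "l \<in> leaves ?S" "Z l \<noteq> c f l" by blast
        with card[of l] finL have "(\<Prod>l\<in>leaves ?S. card (edge_isos (rep (Z l)) (ideal_subtree ?T (f l)))) = 0"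
          by (intro prod_zero bexI[of _ l]) auto
        with False show ?thesis by simp
      qed
    qed
    \<comment> \<open>That decoration is admissible only if its product is \<open>F\<close>.\<close>
    have "restrict (c f) (leaves ?S) \<in> ?D \<longleftrightarrow> image_mset (c f) (mset_set (leaves ?S)) = F"
    proof -
      have "image_mset (restrict (c f) (leaves ?S)) (mset_set (leaves ?S)) =
          image_mset (c f) (mset_set (leaves ?S))"
        using finL by (intro image_mset_cong) auto
      then show ?thesis by (simp add: decorations_def)
    qed
    then show ?thesis
      using finite_decorations[OF finL] by (simp add: prod cong: sum.cong)
  qed
  \<comment> \<open>An isomorphism onto \<open>C\<close> matches the leaves bijectively, so the
    pruned forest depends on \<open>C\<close> alone and the inner sum below is constant.\<close>
  have img: "image_mset (c f) (mset_set (leaves ?S)) = pruned ?T C" if f: "f \<in> edge_isos ?S C" for f C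
  proof -
    have "inj_on f (leaves ?S)" "f ` leaves ?S = leaves C"
      using f leaves_subset[of ?S] by (auto simp: edge_isos_def bij_betw_def intro: inj_on_subset)
    then have "mset_set (leaves C) = image_mset f (mset_set (leaves ?S))"
      using image_mset_mset_set by metis
    then show ?thesis by (simp add: pruned_def c_def[abs_def] image_mset.compositionality comp_def)
  qed
  have "(\<Sum>Z\<in>?D. card (edge_isos (graft ?S (rep \<circ> Z)) ?T)) =
      (\<Sum>Z\<in>?D. \<Sum>f\<in>root_embs ?S ?T. \<Prod>l\<in>leaves ?S. card (edge_isos (rep (Z l)) (ideal_subtree ?T (f l))))"
    by (intro sum.cong refl, subst card_edge_isos_graft[OF S _ T]) (simp_all add: operadic_tree_rep)
  also have "\<dots> = (\<Sum>f\<in>root_embs ?S ?T. \<Sum>Z\<in>?D. \<Prod>l\<in>leaves ?S. card (edge_isos (rep (Z l)) (ideal_subtree ?T (f l))))"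
    by (rule sum.swap)
  also have "\<dots> = (\<Sum>f\<in>root_embs ?S ?T. if image_mset (c f) (mset_set (leaves ?S)) = F then forest_aut F else 0)"
    using inner by (rule sum.cong[OF refl])
  also have "\<dots> = (\<Sum>C\<in>cuts ?T. \<Sum>f\<in>edge_isos ?S C.
      if image_mset (c f) (mset_set (leaves ?S)) = F then forest_aut F else 0)"
    unfolding root_embs_eq_UN_cuts[OF S T]
    using finite_cuts[OF T] finite_edge_isos[OF S cutsD(1)[OF T]]
    by (intro sum.UNION_disjoint ballI impI edge_isos_cuts_disjoint[OF T]) simp_all
  also have "\<dots> = (\<Sum>C\<in>cuts ?T. \<Sum>f\<in>edge_isos ?S C. if pruned ?T C = F then forest_aut F else 0)"
    by (intro sum.cong refl) (simp add: img)
  \<comment> \<open>Isomorphisms from \<open>rep Y\<close> to \<open>C\<close> number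
    \<open>|Aut (rep Y)|\<close> or none, according to the class of \<open>C\<close>.\<close>
  also have "\<dots> = (\<Sum>C\<in>cuts ?T. if pruned ?T C = F \<and> class_of C = Y then card (Aut ?S) * forest_aut F else 0)"
    by (intro sum.cong refl) (simp add: card_edge_isos_rep[OF cutsD(1)[OF T]])
  also have "\<dots> = card {C \<in> cuts ?T. pruned ?T C = F \<and> class_of C = Y} * (card (Aut ?S) * forest_aut F)"
    using finite_cuts[OF T] by (simp add: sum.If_cases Int_def conj_commute)
  finally show ?thesis by simp
qed

section \<open>Comparison of coefficients\<close>

lemma coeff_comult_tree:
  "coeff (comult_tree X) (F, Q) =
     (of_nat (card {S \<in> cuts (rep X). pruned (rep X) S = F \<and> {#class_of S#} = Q}) :: 'k::comm_ring_1)"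
  using finite_cuts[OF operadic_tree_rep[of X]]
  by (simp add: comult_tree_def lookup_sum lookup_single when_def sum.If_cases Int_def)

lemma formal_sum_eq_sum:
  assumes "finite J" "J \<subseteq> I" "\<And>i. i \<in> I \<Longrightarrow> F i x \<noteq> 0 \<Longrightarrow> i \<in> J"
  shows "formal_sum F I x = (\<Sum>i\<in>J. F i x)"
  unfolding formal_sum_def using assms by (intro sum.mono_neutral_left) auto

text \<open>The Green function is supported on single trees, so the sum over forests collapses to a
  sum over trees; any finite set of trees containing all those with non-zero coefficient at
  \<open>z\<close> may serve as index set.\<close>

lemma comult_hat_green:
  assumes J: "finite J" "\<And>X. coeff (comult_tree X :: 'k::field_char_0 tree_algebra2) z \<noteq> 0 \<Longrightarrow> X \<in> J"
  shows "comult_hat green z = (\<Sum>X\<in>J. green {#X#} * coeff (comult_tree X) z :: 'k)"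
proof -
  have "comult_hat green z = (\<Sum>m\<in>(\<lambda>X. {#X#}) ` J. green m * coeff (comult (monomial m)) z :: 'k)"
    unfolding comult_hat_def
  proof (rule formal_sum_eq_sum)
    fix m assume m: "green m * coeff (comult (monomial m)) z \<noteq> (0::'k)"
    then obtain X where X: "m = {#X#}" using green_eq_0[where 'k = 'k, of m] by fastforce
    with m J(2)[of X] show "m \<in> (\<lambda>X. {#X#}) ` J" by (auto simp: comult_generator)
  qed (use J in auto)
  also have "\<dots> = (\<Sum>X\<in>J. green {#X#} * coeff (comult_tree X) z)"
    by (subst sum.reindex) (simp_all add: comult_generator inj_on_def)
  finally show ?thesis .
qed

text \<open>The double count is divided by the automorphism numbers and summed over the trees
  \<open>X\<close> that are cut.\<close>

lemma comult_hat_green_singleton: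
  "comult_hat green (F, {#Y#}) =
     (series_power green (card (leaves (rep Y))) F * green {#Y#} :: 'k::field_char_0)"
proof -
  let ?D = "decorations (leaves (rep Y)) F"
  let ?N = "\<lambda>X. card {S \<in> cuts (rep X). pruned (rep X) S = F \<and> class_of S = Y}"
  let ?A = "\<lambda>X. card (Aut (rep X))"
  note finL = finite_leaves[OF operadic_tree_rep, of Y]
  note finD = finite_decorations[OF finL, of F]
  have pos: "?A X > 0" for X by (rule finite_Aut(2)[OF operadic_tree_rep])
  have "\<exists>X. \<forall>X'. card (edge_isos (graft (rep Y) (rep \<circ> Z)) (rep X')) = (if X' = X then ?A X' else 0)" for Z
    using ex_tree_class[OF operadic_tree_graft(1)[of "rep Y" "rep \<circ> Z"]] operadic_tree_rep
    by (metis comp_apply)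
  \<comment> \<open>\<open>H Z\<close> is the class of the tree obtained by grafting the decoration
    \<open>Z\<close> onto \<open>rep Y\<close>.\<close>
  then obtain H where H: "\<And>Z X'. card (edge_isos (graft (rep Y) (rep \<circ> Z)) (rep X')) =
      (if X' = H Z then ?A X' else 0)" by metis
  have N: "?N X * ?A Y * forest_aut F = card {Z \<in> ?D. X = H Z} * ?A X" for X
    unfolding sum_card_edge_isos_graft[symmetric] H
    by (subst sum.If_cases[OF finD]) (simp only: sum_constant sum.neutral_const Int_def mem_Collect_eq add_0_right of_nat_id)
  have coeff: "coeff (comult_tree X) (F, {#Y#}) = (of_nat (?N X) :: 'k)" for X
    by (simp add: coeff_comult_tree)
  \<comment> \<open>By \<open>N\<close>, a tree having a cut of shape \<open>Y\<close> with pruned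
    forest \<open>F\<close> is the grafting of some decoration, so \<open>H\<close> applied to the
    finite set of decorations gives an admissible index set.\<close>
  have "comult_hat green (F, {#Y#}) = (\<Sum>X\<in>H ` ?D. green {#X#} * of_nat (?N X) :: 'k)"
    unfolding coeff[symmetric]
  proof (rule comult_hat_green)
    fix X assume "coeff (comult_tree X :: 'k tree_algebra2) (F, {#Y#}) \<noteq> 0"
    then have "?N X \<noteq> 0" unfolding coeff by (metis of_nat_0)
    then have "?N X * ?A Y * forest_aut F \<noteq> 0" using pos[of Y] forest_aut_pos[of F] by simp
    then have "card {Z \<in> ?D. X = H Z} \<noteq> 0" unfolding N by simp
    then show "X \<in> H ` ?D" by (auto dest: card_ge_0_finite simp: card_eq_0_iff)
  qed (use finD in simp)
  \<comment> \<open>The factor \<open>|Aut (rep X)|\<close> in \<open>N\<close> cancels against the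
    coefficient of the Green function at \<open>X\<close>.\<close>
  also have "\<dots> = (\<Sum>X\<in>H ` ?D. of_nat (card {Z \<in> ?D. X = H Z}) / (of_nat (?A Y) * of_nat (forest_aut F)))"
  proof (intro sum.cong refl)
    fix X
    have "of_nat (?N X) * of_nat (?A Y) * of_nat (forest_aut F) =
        (of_nat (card {Z \<in> ?D. X = H Z}) * of_nat (?A X) :: 'k)"
      using arg_cong[OF N[of X], of "of_nat :: nat \<Rightarrow> 'k"] by simp
    then show "green {#X#} * of_nat (?N X) =
        (of_nat (card {Z \<in> ?D. X = H Z}) / (of_nat (?A Y) * of_nat (forest_aut F)) :: 'k)"
      using pos[of X] pos[of Y] forest_aut_pos[of F] by (simp add: green_singleton field_simps)
  qed
  also have "\<dots> = of_nat (\<Sum>X\<in>H ` ?D. card {Z \<in> ?D. X = H Z}) / (of_nat (?A Y) * of_nat (forest_aut F))"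
    by (simp add: sum_divide_distrib)
  \<comment> \<open>The fibres of \<open>H\<close> partition the decorations.\<close>
  also have "(\<Sum>X\<in>H ` ?D. card {Z \<in> ?D. X = H Z}) = card ?D"
    using sum.image_gen[OF finD, of "\<lambda>_. 1::nat" H] by (simp add: eq_commute)
  also have "of_nat (card ?D) / (of_nat (?A Y) * of_nat (forest_aut F)) =
      (series_power green (card (leaves (rep Y))) F * green {#Y#} :: 'k)"
    by (simp add: series_power_green[OF finL] green_singleton)
  finally show ?thesis .
qed

theorem theorem2p5:
  shows "((\<lambda>n. series_power green n \<otimes> green_leaves n) has_formal_sum
           comult_hat (green :: 'k::field_char_0 tree_series)) UNIV"
  unfolding has_formal_sum_def
proof (intro allI)
  fix z :: "forest \<times> forest"
  obtain F Q where z: "z = (F, Q)" by (cases z)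
  let ?t = "\<lambda>n. (series_power green n \<otimes> green_leaves n) z :: 'k"
  show "finite {n \<in> UNIV. ?t n \<noteq> 0} \<and> comult_hat green z = (\<Sum>n | n \<in> UNIV \<and> ?t n \<noteq> 0. ?t n)"
  \<comment> \<open>On both sides the second tensor factor is always a single tree, so all other
    \<open>Q\<close> have coefficient zero.\<close>
  proof (cases "\<exists>Y. Q = {#Y#}")
    case True
    then obtain Y where Q: "Q = {#Y#}" by blast
    let ?n = "card (leaves (rep Y))"
    \<comment> \<open>The tree \<open>Y\<close> occurs in the summand of the Green function for its
      own number of leaves only, so at most one \<open>n\<close> contributes.\<close>
    have t: "?t n = (if n = ?n then comult_hat green z else 0)" for n
      by (simp add: z Q tensor_def green_leaves_singleton comult_hat_green_singleton)
    have "{n \<in> UNIV. ?t n \<noteq> 0} = (if comult_hat green z = (0::'k) then {} else {?n})"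
      by (auto simp: t)
    then show ?thesis by (simp add: t)
  next
    case False
    then have "?t n = 0" for n by (simp add: z tensor_def green_leaves_eq_0)
    moreover have "comult_hat green z = (\<Sum>X\<in>{}. green {#X#} * coeff (comult_tree X) z :: 'k)"
      by (rule comult_hat_green) (use False in \<open>auto simp: z coeff_comult_tree card_gt_0_iff\<close>)
    ultimately show ?thesis by simp
  qed
qed

end
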